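(* Let $\Bbbk$ be a field of characteristic zero. (a) For every integer $n\ge 1$, the radical of the Hilbert ideal $I_n=A_{n,+}R_n$ is $$\sqrt{I_n}=(x_0,\ldots,x_{[n/2]})R_n .$$ (b) For every integer $n\ge1$, $\pi_{n-[n/2]-1,\,n}(A_n)=\Bbbk$. (c) For every odd integer $m\ge 1$, $\pi_{m,2m}(A_{2m})=\Bbbk[x_0^2]$. (d) For every even integer $m\ge 2$, $\pi_{m,2m}(A_{2m})=\Bbbk[x_0^2,x_0^3]$.
   Context: $\Bbbk$ is a field of characteristic zero and $[x]$ denotes the largest integer $\le x$. $R_n:=\Bbbk[x_0,\ldots,x_n]$ is the polynomial ring, $D_n:=x_0\frac{\partial}{\partial x_1}+\ldots+x_{n-1}\frac{\partial}{\partial x_n}$ is the Weitzenböck derivation on $R_n$, and $A_n:=\ker D_n$, which is a graded subalgebra of $R_n$ (it is the invariant ring of the basic action $a*f=\exp(aD_n)f$ of the additive group $\mathbb{G}_a$ of $\Bbbk$). $A_{n,+}$ denotes the set of elements of $A_n$ with zero constant term, and the Hilbert ideal is the ideal $I_n:=A_{n,+}R_n$ of $R_n$ generated by $A_{n,+}$. For $0\le m<n$, $\pi_{m,n}:R_n\to R_m$ is the $\Bbbk$-algebra homomorphism $f(x_0,\ldots,x_n)\mapsto f(0,\ldots,0,x_0,\ldots,x_m)$ with $n-m$ zeros, i.e. $x_i\mapsto 0$ for $i<n-m$ and $x_{n-m+j}\mapsto x_j$ for $0\le j\le m$. *)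

theory Defs
  imports
    "HOL-Library.Poly_Mapping"
    "HOL-Algebra.Ideal"
    "HOL-Algebra.Generated_Rings"
begin

text \<open>Polynomials in the variables \<open>x\<^sub>0, x\<^sub>1, \<dots>\<close>: finitely supported functions from exponent vectors
  to coefficients, with the (convolution) ring structure of \<^theory>\<open>HOL-Library.Poly_Mapping\<close>.\<close>

type_synonym 'k mpoly = "(nat \<Rightarrow>\<^sub>0 nat) \<Rightarrow>\<^sub>0 'k"

definition mconst :: "'k \<Rightarrow> 'k::comm_ring_1 mpoly" where
  "mconst c = Poly_Mapping.single 0 c"

definition mvar :: "nat \<Rightarrow> 'k::comm_ring_1 mpoly" where
  "mvar i = Poly_Mapping.single (Poly_Mapping.single i 1) 1"

text \<open>\<open>R\<^sub>n = k[x\<^sub>0, \<dots>, x\<^sub>n]\<close> consists of the polynomials involving no variable of index above \<open>n\<close>.\<close>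

definition Rn :: "nat \<Rightarrow> 'k::comm_ring_1 mpoly ring" where
  "Rn n = \<lparr> carrier = {p. \<forall>u \<in> Poly_Mapping.keys p. Poly_Mapping.keys u \<subseteq> {..n}},
            monoid.mult = (*), one = 1, zero = 0, add = (+) \<rparr>"

definition pderiv_wrt :: "nat \<Rightarrow> 'k mpoly \<Rightarrow> 'k::comm_ring_1 mpoly" where
  "pderiv_wrt i p =
     (\<Sum>u \<in> Poly_Mapping.keys p.
        Poly_Mapping.single (u - Poly_Mapping.single i 1)
          (of_nat (Poly_Mapping.lookup u i) * Poly_Mapping.lookup p u))"

text \<open>The substitution homomorphism over the coefficient ring sending \<open>x\<^sub>i\<close> to \<open>s i\<close>.\<close>

definition msubst :: "(nat \<Rightarrow> 'k mpoly) \<Rightarrow> 'k mpoly \<Rightarrow> 'k::comm_ring_1 mpoly" where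
  "msubst s p =
     (\<Sum>u \<in> Poly_Mapping.keys p.
        mconst (Poly_Mapping.lookup p u) *
        (\<Prod>i \<in> Poly_Mapping.keys u. s i ^ Poly_Mapping.lookup u i))"

definition weitzenboeck :: "nat \<Rightarrow> 'k mpoly \<Rightarrow> 'k::comm_ring_1 mpoly" where
  "weitzenboeck n p = (\<Sum>i<n. mvar i * pderiv_wrt (Suc i) p)"

definition An :: "nat \<Rightarrow> 'k::comm_ring_1 mpoly set" where
  "An n = {f \<in> carrier (Rn n). weitzenboeck n f = 0}"

definition An_plus :: "nat \<Rightarrow> 'k::comm_ring_1 mpoly set" where
  "An_plus n = {f \<in> An n. Poly_Mapping.lookup f 0 = 0}"

definition hilbert_ideal :: "nat \<Rightarrow> 'k::comm_ring_1 mpoly set" where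
  "hilbert_ideal n = Idl\<^bsub>Rn n\<^esub> (An_plus n)"

definition ideal_radical :: "('a, 'b) ring_scheme \<Rightarrow> 'a set \<Rightarrow> 'a set" where
  "ideal_radical R I = {f \<in> carrier R. \<exists>k::nat. f [^]\<^bsub>R\<^esub> k \<in> I}"

definition proj :: "nat \<Rightarrow> nat \<Rightarrow> 'k mpoly \<Rightarrow> 'k::comm_ring_1 mpoly" where
  "proj m n = msubst (\<lambda>i. if i < n - m then 0 else mvar (i - (n - m)))"

text \<open>The subalgebra \<open>k[S]\<close> of \<open>R\<^sub>n\<close> is the subring generated by the constants and \<open>S\<close>.\<close>

definition generated_subalgebra :: "nat \<Rightarrow> 'k mpoly set \<Rightarrow> 'k::comm_ring_1 mpoly set" where
  "generated_subalgebra n S = generate_ring (Rn n) (range mconst \<union> S)"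

end

theory Submission
  imports Defs "HOL-Computational_Algebra.Polynomial"
begin

text \<open>The kernel of the Weitzenboeck derivation consists of the highest weight vectors for an action of
  the Lie algebra \<open>sl\<^sub>2\<close>, where \<open>x\<^sub>i\<close> has weight \<open>n - 2 i\<close>; highest weights are nonnegative, so every
  nonconstant monomial of a constant of the derivation involves some \<open>x\<^sub>i\<close> with \<open>2 i \<le> n\<close>.  Conversely the
  quadratic constants \<open>\<Sum>\<^sub>j (-1)\<^sup>j x\<^sub>j x\<^bsub>2i-j\<^esub>\<close> with \<open>2 i \<le> n\<close> put \<open>x\<^sub>i\<^sup>2\<close> into the Hilbert ideal modulo
  \<open>x\<^sub>0, \<dots>, x\<^bsub>i-1\<^esub>\<close>.  For \<open>n = 2 m\<close> only the powers of \<open>x\<^sub>m\<close> survive the projection.  Their odd powers cannot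
  occur for odd \<open>m\<close>, because an orbit joins two points that differ in the sign of \<open>x\<^sub>m\<close> and whose
  coordinates beyond \<open>x\<^sub>m\<close> vanish.  For even \<open>m\<close> a cubic constant containing \<open>x\<^sub>m\<^sup>3\<close> comes
  from the translation invariant polynomial \<open>((a - b) (b - c) (c - a))\<^sup>m\<close>.\<close>

text \<open>That highest weights are nonnegative is derived by direct computation. If
  \<open>f\<close> is a constant of weight \<open>L\<close> and F is the lowering operator, then D
  F^(k+1) f = (k + 1) (L - k) F^k f. For \<open>L < 0\<close> no factor vanishes in characteristic
  zero, whereas some power of F kills \<open>f\<close>, because F moves indices up; so
  \<open>f = 0\<close>. For odd \<open>m\<close>, a constant does not vary along a polynomial curve
  whose coordinates satisfy s_i' = s_(i-1). The successive derivatives of (t^2 - 1)^m form such a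
  curve: the zeros of order \<open>m\<close> at 1 and -1 kill the coordinates beyond the middle and
  leave m! 2^m and m! (-2)^m in the middle. The coordinates below the middle are not controlled
  there, which is why \<open>f\<close> is first cut down to its part of weight zero. For even
  \<open>m\<close> only the nonvanishing of one coefficient matters, the one of (a b c)^m. Parity is
  essential: an odd power of (a - b) (b - c) (c - a) is alternating and has no such term.\<close>

abbreviation lookup :: "('a \<Rightarrow>\<^sub>0 'b::zero) \<Rightarrow> 'a \<Rightarrow> 'b" where "lookup \<equiv> Poly_Mapping.lookup"
abbreviation keys :: "('a \<Rightarrow>\<^sub>0 'b::zero) \<Rightarrow> 'a set" where "keys \<equiv> Poly_Mapping.keys"
abbreviation single :: "'a \<Rightarrow> 'b::zero \<Rightarrow> 'a \<Rightarrow>\<^sub>0 'b" where "single \<equiv> Poly_Mapping.single"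

section \<open>Linear maps out of the polynomial ring\<close>

lemma poly_mapping_eq_sum_single:
  fixes p :: "'a \<Rightarrow>\<^sub>0 'b::comm_monoid_add"
  shows "p = (\<Sum>u\<in>keys p. single u (lookup p u))"
  by (rule poly_mapping_eqI)
    (simp add: lookup_sum lookup_single when_def sum.delta in_keys_iff)

lemma poly_mapping_single_induct [case_names single add]:
  fixes p :: "'a \<Rightarrow>\<^sub>0 'b::comm_monoid_add"
  assumes "\<And>u c. P (single u c)" and "\<And>p q. P p \<Longrightarrow> P q \<Longrightarrow> P (p + q)"
  shows "P p"
proof -
  have "P (\<Sum>u\<in>A. single u (lookup p u))" if "finite A" for A
    using that
  proof (induction A rule: finite_induct)
    case empty
    then show ?case using assms(1)[of undefined 0] by simp
  qed (simp add: assms)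
  then show ?thesis using poly_mapping_eq_sum_single[of p] by (metis finite_keys)
qed

lemma mvar_power: "(mvar i :: 'k::comm_ring_1 mpoly) ^ k = single (single i k) 1"
  by (induction k) (simp_all add: mvar_def mult_single single_add[symmetric])

lemma mpoly_induct [case_names const var add mult]:
  fixes p :: "'k::comm_ring_1 mpoly"
  assumes const: "\<And>c. P (mconst c)" and var: "\<And>i. P (mvar i)"
    and add: "\<And>p q. P p \<Longrightarrow> P q \<Longrightarrow> P (p + q)" and mult: "\<And>p q. P p \<Longrightarrow> P q \<Longrightarrow> P (p * q)"
  shows "P p"
proof (induction p rule: poly_mapping_single_induct)
  case (single u c)
  have "P (single u 1)"
  \<comment> \<open>Exponent vectors are finitely supported functions too, so the same rule builds a
    monomial from powers of variables.\<close>
  proof (induction u rule: poly_mapping_single_induct)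
    case (single i k)
    have "P (mvar i ^ k)"
      by (induction k) (use const[of 1] in \<open>simp_all add: mconst_def var mult\<close>)
    then show ?case by (simp add: mvar_power)
  next
    case (add u v)
    then show ?case using mult[OF add] by (simp add: mult_single)
  qed
  then show ?case
    using mult[OF const[of c]] by (force simp: mconst_def mult_single)
qed (rule add)

text \<open>A sum over \<open>keys p\<close> is not visibly additive in \<open>p\<close>, since keys
  can cancel. Partial derivatives, substitutions and the umbral map all have this shape and share
  \<open>lin_ext_add\<close>.\<close>

definition lin_ext :: "('a \<Rightarrow> 'b \<Rightarrow> 'c) \<Rightarrow> ('a \<Rightarrow>\<^sub>0 'b::comm_monoid_add) \<Rightarrow> 'c::comm_monoid_add" where
  "lin_ext \<phi> p = (\<Sum>u\<in>keys p. \<phi> u (lookup p u))"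

lemma lin_ext_single: "\<phi> u 0 = 0 \<Longrightarrow> lin_ext \<phi> (single u c) = \<phi> u c"
  by (simp add: lin_ext_def)

lemma lin_ext_add:
  assumes "\<And>u. \<phi> u 0 = 0" and "\<And>u a b. \<phi> u (a + b) = \<phi> u a + \<phi> u b"
  shows "lin_ext \<phi> (p + q) = lin_ext \<phi> p + lin_ext \<phi> q"
  unfolding lin_ext_def by (rule setsum_keys_plus_distrib) (simp_all add: assms)

lemma lookup_mult_sum:
  fixes p q :: "'a::comm_monoid_add \<Rightarrow>\<^sub>0 'b::comm_semiring_1"
  shows "lookup (p * q) w = (\<Sum>u\<in>keys p. \<Sum>v\<in>keys q. if u + v = w then lookup p u * lookup q v else 0)"
proof -
  have "p * q = (\<Sum>u\<in>keys p. \<Sum>v\<in>keys q. single (u + v) (lookup p u * lookup q v))"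
    by (subst poly_mapping_eq_sum_single[of p], subst poly_mapping_eq_sum_single[of q])
      (simp add: sum_product mult_single)
  then show ?thesis
    by (simp add: lookup_sum lookup_single when_def)
qed

text \<open>Subtraction of exponents truncates at zero, so monomials free of the variable need the
  separate case.\<close>

lemma lookup_mvar_mult:
  fixes p :: "'k::comm_ring_1 mpoly"
  shows "lookup (mvar i * p) u = (if lookup u i = 0 then 0 else lookup p (u - single i 1))"
proof (induction p arbitrary: u rule: poly_mapping_single_induct)
  case (single v c)
  have "single i 1 + v = u \<longleftrightarrow> lookup u i \<noteq> 0 \<and> v = u - single i (1::nat)"
  proof
    assume "lookup u i \<noteq> 0 \<and> v = u - single i 1"
    then show "single i 1 + v = u"
      by (intro poly_mapping_eqI) (auto simp: lookup_add lookup_minus lookup_single when_def)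
  qed (auto simp: lookup_add)
  then show ?case
    by (auto simp: mvar_def mult_single lookup_single when_def)
qed (simp add: distrib_left lookup_add)

lemma mconst_add: "mconst (a + b) = mconst a + mconst b"
  and mconst_mult: "mconst (a * b) = mconst a * mconst b"
  and mconst_0 [simp]: "mconst 0 = 0"
  and mconst_1 [simp]: "mconst 1 = 1"
  by (simp_all add: mconst_def single_add mult_single)

lemma lookup_mconst_mult: "lookup (mconst c * p) u = c * lookup p u"
proof (induction p rule: poly_mapping_single_induct)
  case (single v a)
  then show ?case by (simp add: mconst_def mult_single lookup_single when_def)
qed (simp add: lookup_add distrib_left)

lemma mconst_of_int: "mconst (of_int k) = of_int k"
  by (simp add: mconst_def)

section \<open>Derivations\<close>

definition derivation :: "('k::comm_ring_1 mpoly \<Rightarrow> 'k mpoly) \<Rightarrow> bool" where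
  "derivation \<delta> \<longleftrightarrow> (\<forall>p q. \<delta> (p + q) = \<delta> p + \<delta> q) \<and> (\<forall>p q. \<delta> (p * q) = p * \<delta> q + q * \<delta> p)
     \<and> (\<forall>c. \<delta> (mconst c) = 0)"

lemma derivation_add: "derivation \<delta> \<Longrightarrow> \<delta> (p + q) = \<delta> p + \<delta> q"
  and derivation_mult: "derivation \<delta> \<Longrightarrow> \<delta> (p * q) = p * \<delta> q + q * \<delta> p"
  and derivation_mconst: "derivation \<delta> \<Longrightarrow> \<delta> (mconst c) = 0"
  by (simp_all add: derivation_def)

lemma derivation_0: "derivation \<delta> \<Longrightarrow> \<delta> 0 = 0"
  using derivation_mconst[of \<delta> 0] by simp

lemma derivation_uminus: "derivation \<delta> \<Longrightarrow> \<delta> (- p) = - \<delta> p"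
  using derivation_add[of \<delta> p "- p"] by (simp add: derivation_0 eq_neg_iff_add_eq_0 add.commute)

lemma derivation_diff: "derivation \<delta> \<Longrightarrow> \<delta> (p - q) = \<delta> p - \<delta> q"
  using derivation_add[of \<delta> p "- q"] by (simp add: derivation_uminus)

lemma derivation_sum: "derivation \<delta> \<Longrightarrow> \<delta> (sum f A) = (\<Sum>x\<in>A. \<delta> (f x))"
  by (induction A rule: infinite_finite_induct) (auto simp: derivation_0 derivation_add)

lemma derivation_mconst_mult: "derivation \<delta> \<Longrightarrow> \<delta> (mconst c * p) = mconst c * \<delta> p"
  by (simp add: derivation_mult derivation_mconst)

lemma derivation_of_int: "derivation \<delta> \<Longrightarrow> \<delta> (of_int k) = 0"
  using derivation_mconst[of \<delta> "of_int k"] by (simp add: mconst_of_int)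

lemma derivation_power_eq_0: "derivation \<delta> \<Longrightarrow> \<delta> p = 0 \<Longrightarrow> \<delta> (p ^ k) = 0"
  using derivation_mconst[of \<delta> 1] by (induction k) (auto simp: derivation_mult)

text \<open>This reduces the commutator relations below to a computation on variables.\<close>

lemma derivation_eqI:
  assumes "derivation \<delta>" "derivation \<epsilon>" "\<And>i. \<delta> (mvar i) = \<epsilon> (mvar i)"
  shows "\<delta> p = \<epsilon> p"
  by (induction p rule: mpoly_induct) (use assms in \<open>auto simp: derivation_def\<close>)

lemma derivation_commutator:
  "derivation \<delta> \<Longrightarrow> derivation \<epsilon> \<Longrightarrow> derivation (\<lambda>p. \<delta> (\<epsilon> p) - \<epsilon> (\<delta> p))"
  by (auto simp: derivation_def algebra_simps derivation_0)

lemma derivation_mult_left: "derivation \<delta> \<Longrightarrow> derivation (\<lambda>p. r * \<delta> p)"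
  by (simp add: derivation_def algebra_simps)

lemma derivation_sum_fun: "(\<And>i. i \<in> A \<Longrightarrow> derivation (\<delta> i)) \<Longrightarrow> derivation (\<lambda>p. \<Sum>i\<in>A. \<delta> i p)"
  unfolding derivation_def
  by (auto simp: sum.distrib[symmetric] sum_distrib_left intro!: sum.cong)

lemma pderiv_wrt_lin_ext:
  "pderiv_wrt i = lin_ext (\<lambda>u c. single (u - single i 1) (of_nat (lookup u i) * c))"
  by (rule ext) (simp add: pderiv_wrt_def lin_ext_def)

lemma pderiv_wrt_single: "pderiv_wrt i (single u c) = single (u - single i 1) (of_nat (lookup u i) * c)"
  unfolding pderiv_wrt_lin_ext by (subst lin_ext_single) auto

lemma pderiv_wrt_add: "pderiv_wrt i (p + q) = pderiv_wrt i p + pderiv_wrt i q"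
  unfolding pderiv_wrt_lin_ext by (rule lin_ext_add) (auto simp: distrib_left single_add)

lemma diff_single_add_eq:
  fixes u v :: "nat \<Rightarrow>\<^sub>0 nat"
  shows "lookup u i \<noteq> 0 \<Longrightarrow> u + v - single i 1 = (u - single i 1) + v"
  by (intro poly_mapping_eqI) (auto simp: lookup_add lookup_minus lookup_single when_def)

lemma pderiv_wrt_mult_single:
  "pderiv_wrt i (single u a * single v b)
     = single u a * pderiv_wrt i (single v b) + single v b * pderiv_wrt i (single u a)"
proof -
  \<comment> \<open>If the variable is absent from the factor that is differentiated, truncation may
    make the two exponents differ, but then the coefficient is zero.\<close>
  have 1: "single (u + v - single i 1) (of_nat (lookup u i) * (a * b))
      = single (u - single i 1 + v) (of_nat (lookup u i) * (a * b))"
    using diff_single_add_eq[of u i v] by (cases "lookup u i = 0") simp_all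
  have 2: "single (u + v - single i 1) (of_nat (lookup v i) * (a * b))
      = single (v - single i 1 + u) (of_nat (lookup v i) * (a * b))"
    using diff_single_add_eq[of v i u]
    by (cases "lookup v i = 0") (simp_all add: add.commute)
  show ?thesis
    using 1 2
    by (simp add: mult_single pderiv_wrt_single lookup_add distrib_left distrib_right single_add ac_simps)
qed

lemma derivation_pderiv_wrt: "derivation (pderiv_wrt i :: 'k::comm_ring_1 mpoly \<Rightarrow> _)"
  unfolding derivation_def
proof (intro conjI allI)
  fix p q :: "'k mpoly"
  show "pderiv_wrt i (p * q) = p * pderiv_wrt i q + q * pderiv_wrt i p"
  proof (induction p rule: poly_mapping_single_induct)
    case (single u a)
    show ?case
      by (induction q rule: poly_mapping_single_induct)
        (simp_all only: pderiv_wrt_mult_single distrib_left distrib_right pderiv_wrt_add ac_simps)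
  qed (simp_all only: distrib_left distrib_right pderiv_wrt_add ac_simps)
qed (simp_all add: pderiv_wrt_add mconst_def pderiv_wrt_single)

lemma pderiv_wrt_mvar: "pderiv_wrt i (mvar j) = (if i = j then 1 else 0)"
  by (auto simp: mvar_def pderiv_wrt_single lookup_single when_def)

text \<open>\<open>weitzenboeck n\<close>, \<open>lowering n\<close>, \<open>cartan n\<close> and
  \<open>translation\<close> all have this form, so their Leibniz rule is inherited from the partial
  derivatives once.\<close>

definition vector_field :: "nat set \<Rightarrow> (nat \<Rightarrow> 'k mpoly) \<Rightarrow> 'k mpoly \<Rightarrow> 'k::comm_ring_1 mpoly" where
  "vector_field A s p = (\<Sum>i\<in>A. s i * pderiv_wrt i p)"

lemma derivation_vector_field: "derivation (vector_field A s)"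
  unfolding vector_field_def by (intro derivation_sum_fun derivation_mult_left derivation_pderiv_wrt)

lemma vector_field_mvar: "finite A \<Longrightarrow> vector_field A s (mvar j) = (if j \<in> A then s j else 0)"
  by (simp add: vector_field_def pderiv_wrt_mvar sum.delta' if_distrib cong: if_cong)

lemma weitzenboeck_vector_field: "weitzenboeck n p = vector_field {1..n} (\<lambda>i. mvar (i - 1)) p"
  unfolding weitzenboeck_def vector_field_def
  by (rule sum.reindex_bij_witness[of _ "\<lambda>i. i - 1" Suc]) auto

lemma derivation_weitzenboeck: "derivation (weitzenboeck n)"
  unfolding weitzenboeck_vector_field by (rule derivation_vector_field)

lemma weitzenboeck_mvar: "weitzenboeck n (mvar j) = (if 1 \<le> j \<and> j \<le> n then mvar (j - 1) else 0)"
  by (simp add: weitzenboeck_vector_field vector_field_mvar)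

lemma lookup_pderiv_wrt:
  fixes p :: "'k::comm_ring_1 mpoly"
  shows "lookup (pderiv_wrt i p) u = of_nat (Suc (lookup u i)) * lookup p (u + single i 1)"
proof (induction p rule: poly_mapping_single_induct)
  case (single v c)
  show ?case
  proof (cases "v = u + single i 1")
    case True
    then show ?thesis by (simp add: pderiv_wrt_single lookup_add)
  next
    case False
    have "lookup v i = 0 \<or> v - single i 1 \<noteq> u"
    proof (rule ccontr)
      assume "\<not> ?thesis"
      then have "v = u + single i 1"
        by (intro poly_mapping_eqI) (auto simp: lookup_add lookup_minus lookup_single when_def)
      with False show False ..
    qed
    then show ?thesis using False by (auto simp: pderiv_wrt_single lookup_single when_def)
  qed
qed (simp add: pderiv_wrt_add lookup_add distrib_left)

lemma lookup_weitzenboeck: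
  "lookup (weitzenboeck n p) u = (\<Sum>i<n. if lookup u i = 0 then 0
     else of_nat (Suc (lookup u (Suc i))) * lookup p (u - single i 1 + single (Suc i) 1))"
  by (simp add: weitzenboeck_def lookup_sum lookup_mvar_mult lookup_pderiv_wrt lookup_minus
      lookup_single when_def cong: if_cong)

section \<open>Weights of constants of the Weitzenboeck derivation\<close>

text \<open>Three weights are used: \<open>sl2_weight n\<close>, the distance
  \<open>int (n - i)\<close> to the last variable, which bounds how often \<open>lowering n\<close>
  can act, and the constant 1, which gives the degree.\<close>

definition wdeg :: "nat \<Rightarrow> (nat \<Rightarrow> int) \<Rightarrow> (nat \<Rightarrow>\<^sub>0 nat) \<Rightarrow> int" where
  "wdeg n w u = (\<Sum>i\<le>n. w i * int (lookup u i))"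

lemma wdeg_add: "wdeg n w (u + v) = wdeg n w u + wdeg n w v"
  by (simp add: wdeg_def lookup_add distrib_left sum.distrib)

lemma wdeg_single: "wdeg n w (single j k) = (if j \<le> n then w j * int k else 0)"
  by (simp add: wdeg_def lookup_single when_def if_distrib cong: if_cong)

lemma sub_single_add_cancel:
  fixes u :: "nat \<Rightarrow>\<^sub>0 nat"
  shows "lookup u i \<noteq> 0 \<Longrightarrow> u - single i 1 + single i 1 = u"
  by (intro poly_mapping_eqI) (auto simp: lookup_add lookup_minus lookup_single when_def)

lemma wdeg_exchange:
  assumes "lookup u i \<noteq> 0" "i \<le> n" "j \<le> n"
  shows "wdeg n w (u - single i 1 + single j 1) = wdeg n w u - w i + w j"
  using arg_cong[OF sub_single_add_cancel[OF assms(1)], of "wdeg n w"] assms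
  by (simp add: wdeg_add wdeg_single)

definition wpart :: "nat \<Rightarrow> (nat \<Rightarrow> int) \<Rightarrow> int \<Rightarrow> 'k::comm_ring_1 mpoly \<Rightarrow> 'k mpoly" where
  "wpart n w c p = (\<Sum>u\<in>{u \<in> keys p. wdeg n w u = c}. single u (lookup p u))"

lemma lookup_wpart: "lookup (wpart n w c p) u = (if wdeg n w u = c then lookup p u else 0)"
  by (auto simp: wpart_def lookup_sum lookup_single when_def in_keys_iff sum.delta)

lemma wpart_0 [simp]: "wpart n w c 0 = 0"
  by (simp add: wpart_def)

lemma keys_wpart: "keys (wpart n w c p) = {u \<in> keys p. wdeg n w u = c}"
  by (auto simp: in_keys_iff lookup_wpart split: if_splits)

lemma weitzenboeck_wpart:
  assumes w: "\<And>i. i < n \<Longrightarrow> w i = w (Suc i) + s"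
  shows "weitzenboeck n (wpart n w c p) = wpart n w (c + s) (weitzenboeck n p)"
proof (rule poly_mapping_eqI)
  fix u
  have "wdeg n w (u - single i 1 + single (Suc i) 1) = wdeg n w u - s"
    if "i < n" "lookup u i \<noteq> 0" for i
    using wdeg_exchange[of u i n "Suc i" w] w[of i] that by simp
  then show "lookup (weitzenboeck n (wpart n w c p)) u = lookup (wpart n w (c + s) (weitzenboeck n p)) u"
    by (auto simp: lookup_weitzenboeck lookup_wpart intro!: sum.cong sum.neutral)
qed

section \<open>The action of sl2 by derivations\<close>

definition sl2_weight :: "nat \<Rightarrow> nat \<Rightarrow> int" where
  "sl2_weight n i = int n - 2 * int i"

text \<open>The coefficients are chosen to make the commutator with the Weitzenboeck derivation
  diagonal: (j + 1) (n - j) - j (n - j + 1) = n - 2 j, which is the weight of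
  \<open>mvar j\<close>.\<close>

definition lowering :: "nat \<Rightarrow> 'k mpoly \<Rightarrow> 'k::comm_ring_1 mpoly" where
  "lowering n = vector_field {..<n} (\<lambda>i. of_int ((int i + 1) * (int n - int i)) * mvar (Suc i))"

definition cartan :: "nat \<Rightarrow> 'k mpoly \<Rightarrow> 'k::comm_ring_1 mpoly" where
  "cartan n = vector_field {..n} (\<lambda>i. of_int (sl2_weight n i) * mvar i)"

lemma derivation_lowering: "derivation (lowering n)" and derivation_cartan: "derivation (cartan n)"
  by (simp_all add: lowering_def cartan_def derivation_vector_field)

lemma derivation_of_int_mult: "derivation \<delta> \<Longrightarrow> \<delta> (of_int k * p) = of_int k * \<delta> p"
  by (simp add: derivation_mult derivation_of_int)

lemma lowering_mvar:
  "lowering n (mvar j) = (if j < n then of_int ((int j + 1) * (int n - int j)) * mvar (Suc j) else 0)"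
  by (simp add: lowering_def vector_field_mvar)

lemma cartan_mvar: "cartan n (mvar j) = (if j \<le> n then of_int (sl2_weight n j) * mvar j else 0)"
  by (simp add: cartan_def vector_field_mvar)

lemma commutator_weitzenboeck_lowering:
  fixes p :: "'k::comm_ring_1 mpoly"
  shows "weitzenboeck n (lowering n p) - lowering n (weitzenboeck n p) = cartan n p"
proof (rule derivation_eqI[where \<delta> = "\<lambda>p. weitzenboeck n (lowering n p) - lowering n (weitzenboeck n p)"])
  fix j
  have "of_int ((int j + 1) * (int n - int j)) * mvar j - of_int (int j * (int n - int j + 1)) * mvar j
      = of_int (sl2_weight n j) * (mvar j :: 'k mpoly)"
    unfolding left_diff_distrib[symmetric] of_int_diff[symmetric]
    by (simp add: sl2_weight_def algebra_simps)
  moreover have "lowering n (weitzenboeck n (mvar j :: 'k mpoly))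
      = (if j \<le> n then of_int (int j * (int n - int j + 1)) * mvar j else 0)"
    by (cases j) (auto simp: weitzenboeck_mvar lowering_mvar derivation_0[OF derivation_lowering] algebra_simps)
  moreover have "weitzenboeck n (lowering n (mvar j :: 'k mpoly))
      = (if j \<le> n then of_int ((int j + 1) * (int n - int j)) * mvar j else 0)"
    by (auto simp: weitzenboeck_mvar lowering_mvar derivation_0[OF derivation_weitzenboeck]
        derivation_of_int_mult[OF derivation_weitzenboeck] simp del: of_int_mult)
  ultimately show "weitzenboeck n (lowering n (mvar j)) - lowering n (weitzenboeck n (mvar j))
      = cartan n (mvar j :: 'k mpoly)"
    by (simp add: cartan_mvar del: of_int_mult)
qed (simp_all add: derivation_commutator derivation_weitzenboeck derivation_lowering derivation_cartan)

lemma commutator_cartan_lowering: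
  fixes p :: "'k::comm_ring_1 mpoly"
  shows "cartan n (lowering n p) - lowering n (cartan n p) = of_int (- 2) * lowering n p"
proof (rule derivation_eqI[where \<delta> = "\<lambda>p. cartan n (lowering n p) - lowering n (cartan n p)"
      and \<epsilon> = "\<lambda>p. of_int (- 2) * lowering n p"])
  fix j
  define c where "c = (of_int ((int j + 1) * (int n - int j)) :: 'k mpoly)"
  have "c * (of_int (sl2_weight n (Suc j)) * mvar (Suc j)) - of_int (sl2_weight n j) * (c * mvar (Suc j))
     = of_int (- 2) * (c * mvar (Suc j))"
    by (simp add: sl2_weight_def algebra_simps)
  moreover have "cartan n (c * mvar (Suc j)) = c * cartan n (mvar (Suc j))"
    unfolding c_def by (rule derivation_of_int_mult[OF derivation_cartan])
  ultimately show "cartan n (lowering n (mvar j)) - lowering n (cartan n (mvar j))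
      = of_int (- 2) * lowering n (mvar j :: 'k mpoly)"
    unfolding lowering_mvar cartan_mvar c_def[symmetric]
    by (cases "j < n"; cases "j \<le> n")
      (simp_all add: cartan_mvar lowering_mvar derivation_0[OF derivation_cartan] derivation_0[OF derivation_lowering]
        derivation_of_int_mult[OF derivation_lowering] c_def[symmetric] del: of_int_mult)
qed (simp_all add: derivation_commutator derivation_mult_left derivation_lowering derivation_cartan
      del: of_int_minus of_int_numeral)

lemma lookup_of_int_mult: "lookup (of_int k * p) u = of_int k * lookup (p :: 'k::comm_ring_1 mpoly) u"
  using lookup_mconst_mult[of "of_int k" p u] by (simp add: mconst_of_int)

text \<open>Euler's identity: a variable times its partial derivative multiplies a monomial by the
  exponent of that variable.\<close>

lemma cartan_single:
  "cartan n (single u c) = of_int (wdeg n (sl2_weight n) u) * single u (c :: 'k::comm_ring_1)"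
proof -
  have *: "(of_int k * mvar i) * pderiv_wrt i (single u c)
      = of_int (k * int (lookup u i)) * single u c" for i k
  proof (rule poly_mapping_eqI)
    fix v
    have "lookup (mvar i * pderiv_wrt i (single u c)) v = of_nat (lookup u i) * lookup (single u c) v"
    proof (cases "lookup v i")
      case (Suc m)
      then have "v - single i 1 + single i 1 = v"
        using sub_single_add_cancel[of v i] by simp
      with Suc show ?thesis
        by (simp add: lookup_mvar_mult lookup_pderiv_wrt lookup_minus)
          (auto simp: lookup_single when_def)
    qed (auto simp: lookup_mvar_mult lookup_single when_def)
    then show "lookup (of_int k * mvar i * pderiv_wrt i (single u c)) v
        = lookup (of_int (k * int (lookup u i)) * single u c) v"
      unfolding mult.assoc lookup_of_int_mult of_int_mult of_int_of_nat_eq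
      using lookup_of_int_mult[of "int (lookup u i)" "single u c" v] by simp
  qed
  show ?thesis
    unfolding cartan_def vector_field_def * wdeg_def
    by (simp add: sum_distrib_right)
qed

lemma cartan_homogeneous:
  assumes "\<And>u. u \<in> keys p \<Longrightarrow> wdeg n (sl2_weight n) u = L"
  shows "cartan n p = of_int L * (p :: 'k::comm_ring_1 mpoly)"
proof -
  have "cartan n p = (\<Sum>u\<in>keys p. cartan n (single u (lookup p u)))"
    by (subst poly_mapping_eq_sum_single[of p]) (simp add: derivation_sum derivation_cartan)
  also have "\<dots> = of_int L * (\<Sum>u\<in>keys p. single u (lookup p u))"
    unfolding sum_distrib_left by (intro sum.cong refl) (simp add: cartan_single assms)
  finally show ?thesis
    using poly_mapping_eq_sum_single[of p] by simp
qed

text \<open>Moving one index from \<open>i\<close> to \<open>i + 1\<close> brings the monomial one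
  step closer to a power of the last variable.\<close>

lemma keys_lowering:
  assumes "u \<in> keys (lowering n p)"
  obtains v where "v \<in> keys p" "wdeg n (\<lambda>i. int (n - i)) v = wdeg n (\<lambda>i. int (n - i)) u + 1"
proof -
  have "lookup (lowering n p) u = (\<Sum>i<n. of_int ((int i + 1) * (int n - int i)) *
      lookup (mvar (Suc i) * pderiv_wrt i p) u)"
    by (simp only: lowering_def vector_field_def lookup_sum mult.assoc lookup_of_int_mult)
  with assms obtain i where i: "i < n" "lookup (mvar (Suc i) * pderiv_wrt i p) u \<noteq> 0"
    by (metis (no_types, lifting) in_keys_iff lessThan_iff mult_zero_right sum.neutral)
  then have u: "lookup u (Suc i) \<noteq> 0" and "u - single (Suc i) 1 + single i 1 \<in> keys p"
    by (auto simp: lookup_mvar_mult lookup_pderiv_wrt in_keys_iff split: if_splits)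
  with i that wdeg_exchange[OF u, of n i] show ?thesis by fastforce
qed

text \<open>The total distance to the last variable is nonnegative and drops by one at each
  application, so it bounds the number of applications with nonzero result.\<close>

lemma lowering_nilpotent:
  assumes "\<And>u. u \<in> keys p \<Longrightarrow> wdeg n (\<lambda>i. int (n - i)) u < int K"
  shows "(lowering n ^^ K) p = 0"
  using assms
proof (induction K arbitrary: p)
  case 0
  have "wdeg n (\<lambda>i. int (n - i)) u \<ge> 0" for u
    by (auto simp: wdeg_def intro!: sum_nonneg)
  then have "keys p = {}" using 0 by (metis all_not_in_conv linorder_not_less of_nat_0)
  then show ?case by simp
next
  case (Suc K)
  have "(lowering n ^^ K) (lowering n p) = 0"
  proof (rule Suc.IH)
    fix u assume "u \<in> keys (lowering n p)"
    then obtain v where "v \<in> keys p" "wdeg n (\<lambda>i. int (n - i)) v = wdeg n (\<lambda>i. int (n - i)) u + 1"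
      by (rule keys_lowering)
    with Suc.prems[of v] show "wdeg n (\<lambda>i. int (n - i)) u < int K" by simp
  qed
  then show ?case by (simp add: funpow_swap1)
qed

text \<open>The standard computation for a highest weight vector. Commuting the derivation past one
  more \<open>lowering n\<close> adds the current weight, and L + (L - 2) + ... + (L - 2 k) = (k +
  1) (L - k).\<close>

lemma weitzenboeck_lowering_funpow:
  fixes f :: "'k::comm_ring_1 mpoly"
  assumes E: "weitzenboeck n f = 0" and H: "cartan n f = of_int L * f"
  shows "cartan n ((lowering n ^^ k) f) = of_int (L - 2 * int k) * (lowering n ^^ k) f"
    and "weitzenboeck n ((lowering n ^^ Suc k) f) = of_int ((int k + 1) * (L - int k)) * (lowering n ^^ k) f"
proof -
  show cartan: "cartan n ((lowering n ^^ k) f) = of_int (L - 2 * int k) * (lowering n ^^ k) f" for k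
  proof (induction k)
    case (Suc k)
    have "cartan n (lowering n ((lowering n ^^ k) f))
        = lowering n (cartan n ((lowering n ^^ k) f)) + of_int (- 2) * lowering n ((lowering n ^^ k) f)"
      using commutator_cartan_lowering[of n "(lowering n ^^ k) f"] by (simp add: algebra_simps)
    also have "\<dots> = of_int (L - 2 * int k + - 2) * lowering n ((lowering n ^^ k) f)"
      unfolding Suc derivation_of_int_mult[OF derivation_lowering] of_int_add distrib_right ..
    also have "L - 2 * int k + - 2 = L - 2 * int (Suc k)" by simp
    finally show ?case by simp
  qed (simp add: H)
  show "weitzenboeck n ((lowering n ^^ Suc k) f) = of_int ((int k + 1) * (L - int k)) * (lowering n ^^ k) f"
  proof (induction k)
    case 0
    show ?case using commutator_weitzenboeck_lowering[of n f]
      by (simp add: E H derivation_0[OF derivation_lowering])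
  next
    case (Suc k)
    let ?g = "(lowering n ^^ k) f"
    have "weitzenboeck n ((lowering n ^^ Suc (Suc k)) f)
        = lowering n (weitzenboeck n (lowering n ?g)) + cartan n (lowering n ?g)"
      using commutator_weitzenboeck_lowering[of n "lowering n ?g"] by (simp add: algebra_simps)
    also have "\<dots> = of_int ((int k + 1) * (L - int k)) * lowering n ?g
        + of_int (L - 2 * int (Suc k)) * lowering n ?g"
    proof -
      have "weitzenboeck n (lowering n ?g) = of_int ((int k + 1) * (L - int k)) * ?g"
        using Suc.IH by simp
      moreover have "cartan n (lowering n ?g) = of_int (L - 2 * int (Suc k)) * lowering n ?g"
        using cartan[of "Suc k"] by simp
      ultimately show ?thesis
        by (simp only: derivation_of_int_mult[OF derivation_lowering])
    qed
    also have "\<dots> = of_int ((int k + 1) * (L - int k) + (L - 2 * int (Suc k))) * lowering n ?g"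
      by (simp only: of_int_add distrib_right)
    also have "(int k + 1) * (L - int k) + (L - 2 * int (Suc k)) = (int (Suc k) + 1) * (L - int (Suc k))"
      by (simp add: algebra_simps)
    finally show ?case by simp
  qed
qed

text \<open>For \<open>L < 0\<close> the factor \<open>(K + 1) * (L - K)\<close> is never zero, so
  the vanishing of a power of \<open>lowering n\<close> at \<open>f\<close> descends from
  \<open>Suc K\<close> to \<open>K\<close> and finally to \<open>f\<close> itself.\<close>

lemma weitzenboeck_kernel_negative_weight:
  fixes f :: "'k::field_char_0 mpoly"
  assumes E: "weitzenboeck n f = 0" and L: "L < 0"
    and hom: "\<And>u. u \<in> keys f \<Longrightarrow> wdeg n (sl2_weight n) u = L"
  shows "f = 0"
proof -
  have inj: "p = 0" if "of_int k * p = 0" "k \<noteq> 0" for k and p :: "'k mpoly"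
  proof (rule poly_mapping_eqI)
    fix u
    show "lookup p u = lookup 0 u"
      using lookup_of_int_mult[of k p u] that by simp
  qed
  have "f = 0" if "(lowering n ^^ K) f = 0" for K
    using that
  proof (induction K)
    case (Suc K)
    have "of_int ((int K + 1) * (L - int K)) * (lowering n ^^ K) f = 0"
      using weitzenboeck_lowering_funpow(2)[OF E cartan_homogeneous[OF hom], of K] Suc.prems
      by (simp add: derivation_0[OF derivation_weitzenboeck])
    moreover have "(int K + 1) * (L - int K) \<noteq> 0" using L by simp
    ultimately show ?case using inj Suc.IH by blast
  qed simp
  \<comment> \<open>The inserted 0 keeps the set nonempty and \<open>M\<close> nonnegative, so that
    \<open>nat (M + 1)\<close> really exceeds every distance.\<close>
  moreover define M where "M = Max (insert 0 (wdeg n (\<lambda>i. int (n - i)) ` keys f))"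
  have "wdeg n (\<lambda>i. int (n - i)) u < int (nat (M + 1))" if "u \<in> keys f" for u
  proof -
    have "0 \<le> M" "wdeg n (\<lambda>i. int (n - i)) u \<le> M"
      unfolding M_def using that by (auto intro!: Max_ge)
    then show ?thesis by simp
  qed
  then have "(lowering n ^^ nat (M + 1)) f = 0" by (rule lowering_nilpotent)
  ultimately show ?thesis by blast
qed

lemma weitzenboeck_kernel_weight_nonneg:
  fixes f :: "'k::field_char_0 mpoly"
  assumes "weitzenboeck n f = 0" "u \<in> keys f"
  shows "wdeg n (sl2_weight n) u \<ge> 0"
proof (rule ccontr)
  let ?L = "wdeg n (sl2_weight n) u"
  assume neg: "\<not> ?L \<ge> 0"
  have "weitzenboeck n (wpart n (sl2_weight n) ?L f) = 0"
    using assms(1) by (subst weitzenboeck_wpart[where s = 2]) (auto simp: sl2_weight_def)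
  then have "wpart n (sl2_weight n) ?L f = 0"
    by (rule weitzenboeck_kernel_negative_weight) (use neg in \<open>auto simp: keys_wpart\<close>)
  then show False
    using assms(2) lookup_wpart[of n "sl2_weight n" ?L f u] by (simp add: in_keys_iff)
qed

section \<open>Exponents occurring in constants\<close>

lemma An_weitzenboeck: "f \<in> An n \<Longrightarrow> weitzenboeck n f = 0"
  and An_carrier: "f \<in> An n \<Longrightarrow> f \<in> carrier (Rn n)"
  by (simp_all add: An_def)

lemma carrier_Rn: "p \<in> carrier (Rn n) \<longleftrightarrow> (\<forall>u\<in>keys p. keys u \<subseteq> {..n})"
  by (simp add: Rn_def)

text \<open>Without variables of positive weight, the weight of \<open>u\<close> is a sum of
  nonpositive terms. Since it is also nonnegative, every term is zero, which leaves only a variable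
  of weight zero.\<close>

lemma An_keys_middle:
  fixes f :: "'k::field_char_0 mpoly"
  assumes f: "f \<in> An n" "u \<in> keys f" and low: "\<And>i. 2 * i < n \<Longrightarrow> lookup u i = 0"
    and i: "2 * i \<noteq> n"
  shows "lookup u i = 0"
proof (cases "i \<le> n")
  case True
  have nonneg: "- (sl2_weight n j * int (lookup u j)) \<ge> 0" for j
    using low[of j] by (cases "2 * j < n") (auto simp: sl2_weight_def mult_le_0_iff)
  have "wdeg n (sl2_weight n) u \<ge> 0"
    using f by (auto intro: weitzenboeck_kernel_weight_nonneg An_weitzenboeck)
  then have "(\<Sum>j\<le>n. - (sl2_weight n j * int (lookup u j))) \<le> 0"
    by (simp add: wdeg_def sum_negf)
  then have "(\<Sum>j\<le>n. - (sl2_weight n j * int (lookup u j))) = 0"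
    using sum_nonneg[of "{..n}", OF nonneg] by (meson antisym)
  then have "- (sl2_weight n i * int (lookup u i)) = 0"
    using sum_nonneg_eq_0_iff[of "{..n}", OF _ nonneg] True by auto
  then show ?thesis using i by (auto simp: sl2_weight_def)
next
  case False
  then show ?thesis
    using f An_carrier[of f n] unfolding carrier_Rn by (metis atMost_iff in_keys_iff subsetD)
qed

text \<open>The bound \<open>n div 2\<close> includes the middle index of an even \<open>n\<close>,
  the one variable that \<open>An_keys_middle\<close> cannot exclude.\<close>

lemma An_keys_low:
  fixes f :: "'k::field_char_0 mpoly"
  assumes "f \<in> An n" "u \<in> keys f" "u \<noteq> 0"
  shows "\<exists>i\<le>n div 2. lookup u i \<noteq> 0"
proof (rule ccontr)
  assume "\<not> ?thesis"
  then have low: "lookup u i = 0" if "i \<le> n div 2" for i using that by blast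
  have "lookup u i = 0" for i
  proof (cases "2 * i = n")
    case False
    show ?thesis by (rule An_keys_middle[OF assms(1,2) low False]) simp
  qed (auto intro: low)
  then have "u = 0" by (intro poly_mapping_eqI) simp
  with assms show False by simp
qed

section \<open>Evaluation homomorphisms\<close>

definition monom_eval :: "(nat \<Rightarrow> 'b::comm_ring_1) \<Rightarrow> (nat \<Rightarrow>\<^sub>0 nat) \<Rightarrow> 'b" where
  "monom_eval s u = (\<Prod>i\<in>keys u. s i ^ lookup u i)"

lemma monom_eval_superset:
  assumes "finite A" "keys u \<subseteq> A"
  shows "monom_eval s u = (\<Prod>i\<in>A. s i ^ lookup u i)"
  unfolding monom_eval_def
  by (rule prod.mono_neutral_left[OF assms]) (auto simp: in_keys_iff)

lemma monom_eval_add: "monom_eval s (u + v) = monom_eval s u * monom_eval s v"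
proof -
  let ?A = "keys u \<union> keys v"
  have "finite ?A" "keys u \<subseteq> ?A" "keys v \<subseteq> ?A" "keys (u + v) \<subseteq> ?A"
    using keys_add[of u v] by auto
  then show ?thesis
    by (simp add: monom_eval_superset[of ?A] lookup_add power_add prod.distrib)
qed

lemma monom_eval_0 [simp]: "monom_eval s 0 = 1"
  by (simp add: monom_eval_def)

lemma monom_eval_single: "monom_eval s (single i k) = s i ^ k"
  by (simp add: monom_eval_def)

lemma monom_eval_eq_0:
  assumes "s i = 0" "lookup u i \<noteq> 0"
  shows "monom_eval s u = 0"
  unfolding monom_eval_def using assms
  by (auto intro!: prod_zero bexI[of _ i] simp: in_keys_iff zero_power)

text \<open>The target ring is left open because three are needed: polynomials for
  \<open>msubst\<close>, univariate polynomials for curves, and the field itself for points on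
  them.\<close>

definition eval_with :: "('k \<Rightarrow> 'b) \<Rightarrow> (nat \<Rightarrow> 'b) \<Rightarrow> 'k::comm_ring_1 mpoly \<Rightarrow> 'b::comm_ring_1" where
  "eval_with c s = lin_ext (\<lambda>u a. c a * monom_eval s u)"

locale coeff_hom =
  fixes c :: "'k::comm_ring_1 \<Rightarrow> 'b::comm_ring_1"
  assumes hom_add: "c (a + b) = c a + c b"
    and hom_mult: "c (a * b) = c a * c b"
    and hom_1: "c 1 = 1"
begin

lemma hom_0: "c 0 = 0"
  using hom_add[of 0 0] by simp

lemma eval_single: "eval_with c s (single u a) = c a * monom_eval s u"
  unfolding eval_with_def by (rule lin_ext_single) (simp add: hom_0)

lemma eval_add: "eval_with c s (p + q) = eval_with c s p + eval_with c s q"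
  unfolding eval_with_def by (rule lin_ext_add) (simp_all add: hom_0 hom_add distrib_right)

lemma eval_mult: "eval_with c s (p * q) = eval_with c s p * eval_with c s q"
proof (induction p rule: poly_mapping_single_induct)
  case (single u a)
  show ?case
    by (induction q rule: poly_mapping_single_induct)
      (simp_all add: mult_single eval_single monom_eval_add hom_mult eval_add distrib_left)
qed (simp add: eval_add distrib_right)

lemma eval_mconst: "eval_with c s (mconst a) = c a"
  by (simp add: mconst_def eval_single)

lemma eval_mvar: "eval_with c s (mvar i) = s i"
  by (simp add: mvar_def eval_single hom_1 monom_eval_single)

lemma eval_0: "eval_with c s 0 = 0"
  using eval_mconst[of s 0] by (simp add: hom_0)

lemma eval_uminus: "eval_with c s (- p) = - eval_with c s p"
  using eval_add[of s p "- p"] by (simp add: eval_0 eq_neg_iff_add_eq_0 add.commute)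

lemma eval_1: "eval_with c s 1 = 1"
  using eval_mconst[of s 1] by (simp add: hom_1)

lemma eval_power: "eval_with c s (p ^ k) = eval_with c s p ^ k"
  by (induction k) (simp_all add: eval_1 eval_mult)

lemma eval_sum: "eval_with c s (sum f A) = (\<Sum>x\<in>A. eval_with c s (f x))"
  by (induction A rule: infinite_finite_induct) (simp_all add: eval_0 eval_add)

end

interpretation mconst: coeff_hom mconst
  by unfold_locales (simp_all add: mconst_add mconst_mult)

lemma msubst_eval_with: "msubst s = eval_with mconst s"
  by (rule ext) (simp add: msubst_def eval_with_def lin_ext_def monom_eval_def)

section \<open>The rings \<open>R\<^sub>n\<close> and their ideals\<close>

lemma Rn_simps [simp]:
  "x \<otimes>\<^bsub>Rn n\<^esub> y = x * y" "x \<oplus>\<^bsub>Rn n\<^esub> y = x + y" "\<one>\<^bsub>Rn n\<^esub> = 1" "\<zero>\<^bsub>Rn n\<^esub> = 0"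
  by (simp_all add: Rn_def)

lemma Rn_add_closed: "p \<in> carrier (Rn n) \<Longrightarrow> q \<in> carrier (Rn n) \<Longrightarrow> p + q \<in> carrier (Rn n)"
  unfolding carrier_Rn using keys_add[of p q] by blast

lemma Rn_mult_closed: "p \<in> carrier (Rn n) \<Longrightarrow> q \<in> carrier (Rn n) \<Longrightarrow> p * q \<in> carrier (Rn n)"
  unfolding carrier_Rn
proof
  fix w assume *: "\<forall>u\<in>keys p. keys u \<subseteq> {..n}" "\<forall>u\<in>keys q. keys u \<subseteq> {..n}" "w \<in> keys (p * q)"
  then obtain u v where "w = u + v" "u \<in> keys p" "v \<in> keys q" using keys_mult[of p q] by blast
  with * show "keys w \<subseteq> {..n}" using keys_add[of u v] by blast
qed

lemma Rn_mconst_closed: "mconst c \<in> carrier (Rn n)"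
  by (auto simp: carrier_Rn mconst_def)

lemma Rn_mvar_closed: "i \<le> n \<Longrightarrow> mvar i \<in> carrier (Rn n)"
  by (auto simp: carrier_Rn mvar_def split: if_splits)

lemma Rn_uminus_closed: "p \<in> carrier (Rn n) \<Longrightarrow> - p \<in> carrier (Rn n)"
  by (auto simp: carrier_Rn in_keys_iff)

lemma Rn_0_closed: "0 \<in> carrier (Rn n)" and Rn_1_closed: "1 \<in> carrier (Rn n)"
  by (auto simp: carrier_Rn)

lemma Rn_power_closed: "p \<in> carrier (Rn n) \<Longrightarrow> p ^ k \<in> carrier (Rn n)"
  by (induction k) (simp_all add: Rn_1_closed Rn_mult_closed)

lemma Rn_sum_closed: "(\<And>x. x \<in> A \<Longrightarrow> f x \<in> carrier (Rn n)) \<Longrightarrow> sum f A \<in> carrier (Rn n)"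
  by (induction A rule: infinite_finite_induct) (auto simp: Rn_0_closed Rn_add_closed)

lemma cring_Rn: "cring (Rn n :: 'k::comm_ring_1 mpoly ring)"
proof (rule cringI)
  show "abelian_group (Rn n :: 'k mpoly ring)"
  proof (rule abelian_groupI)
    fix x :: "'k mpoly" assume "x \<in> carrier (Rn n)"
    then show "\<exists>y\<in>carrier (Rn n). y \<oplus>\<^bsub>Rn n\<^esub> x = \<zero>\<^bsub>Rn n\<^esub>"
      by (intro bexI[of _ "- x"]) (simp_all add: Rn_uminus_closed)
  qed (simp_all add: Rn_add_closed Rn_0_closed ac_simps)
  show "Group.comm_monoid (Rn n :: 'k mpoly ring)"
    by (rule comm_monoidI) (simp_all add: Rn_mult_closed Rn_1_closed ac_simps)
qed (simp add: distrib_right)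

lemma ring_Rn: "ring (Rn n :: 'k::comm_ring_1 mpoly ring)"
  using cring_Rn by (rule cring.axioms)

lemma Rn_a_inv:
  fixes x :: "'k::comm_ring_1 mpoly"
  assumes "x \<in> carrier (Rn n)"
  shows "\<ominus>\<^bsub>Rn n\<^esub> x = - x"
proof -
  interpret ring "Rn n :: 'k mpoly ring" by (rule ring_Rn)
  show ?thesis
    using assms minus_equality[of "- x" x] by (simp add: Rn_uminus_closed)
qed

lemma Rn_nat_pow: "x [^]\<^bsub>Rn n\<^esub> (k :: nat) = x ^ k"
  by (induction k) (simp_all add: nat_pow_def mult.commute)

lemma ideal_RnI:
  fixes I :: "'k::comm_ring_1 mpoly set"
  assumes "I \<subseteq> carrier (Rn n)" "0 \<in> I" "\<And>x y. x \<in> I \<Longrightarrow> y \<in> I \<Longrightarrow> x + y \<in> I"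
    and mult: "\<And>x y. x \<in> I \<Longrightarrow> y \<in> carrier (Rn n) \<Longrightarrow> y * x \<in> I"
  shows "ideal I (Rn n)"
proof (rule idealI[OF ring_Rn])
  interpret ring "Rn n :: 'k mpoly ring" by (rule ring_Rn)
  show "subgroup I (add_monoid (Rn n))"
  proof
    fix x assume x: "x \<in> I"
    then have "\<ominus>\<^bsub>Rn n\<^esub> x = (- 1) * x" using assms(1) Rn_a_inv by auto
    also have "\<dots> \<in> I" using x by (intro mult Rn_uminus_closed Rn_1_closed)
    finally show "inv\<^bsub>add_monoid (Rn n)\<^esub> x \<in> I" by (simp add: a_inv_def)
  qed (use assms in auto)
qed (use mult in \<open>auto simp: mult.commute\<close>)

lemma ideal_Rn_sum_closed:
  assumes "ideal I (Rn n)" "\<And>x. x \<in> A \<Longrightarrow> f x \<in> I"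
  shows "sum f A \<in> I"
  using assms(2)
  by (induction A rule: infinite_finite_induct)
    (use additive_subgroup.zero_closed additive_subgroup.a_closed ideal.axioms(1)[OF assms(1)] in \<open>force+\<close>)

text \<open>For sums, expand the power \<open>k + l\<close> binomially: each term contains
  \<open>x ^ k\<close> or \<open>y ^ l\<close>. The remaining factor is written with
  \<open>mconst\<close> so that its membership in the carrier is available.\<close>

lemma ideal_ideal_radical:
  fixes I :: "'k::comm_ring_1 mpoly set"
  assumes I: "ideal I (Rn n)"
  shows "ideal (ideal_radical (Rn n) I) (Rn n)"
proof -
  interpret ideal I "Rn n" by (rule I)
  have rad: "x \<in> ideal_radical (Rn n) I \<longleftrightarrow> x \<in> carrier (Rn n) \<and> (\<exists>k. x ^ k \<in> I)" for x
    by (simp add: ideal_radical_def Rn_nat_pow)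
  have mult: "y * x \<in> I" if "x \<in> I" "y \<in> carrier (Rn n)" for x y
    using I_l_closed[OF that] by simp
  show ?thesis
  proof (rule ideal_RnI)
    show "0 \<in> ideal_radical (Rn n) I"
      using additive_subgroup.zero_closed[OF ideal.axioms(1)[OF I]]
      by (auto simp: rad Rn_0_closed intro!: exI[of _ "1 :: nat"])
  next
    fix x y assume "x \<in> ideal_radical (Rn n) I" "y \<in> ideal_radical (Rn n) I"
    then obtain k l where x: "x \<in> carrier (Rn n)" "x ^ k \<in> I" and y: "y \<in> carrier (Rn n)" "y ^ l \<in> I"
      by (auto simp: rad)
    have "of_nat (k + l choose i) * x ^ i * y ^ (k + l - i) \<in> I" if "i \<le> k + l" for i
    proof (cases "k \<le> i")
      case True
      then have "x ^ i = x ^ (i - k) * x ^ k" by (simp flip: power_add)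
      then have "of_nat (k + l choose i) * x ^ i * y ^ (k + l - i)
          = (mconst (of_nat (k + l choose i)) * x ^ (i - k) * y ^ (k + l - i)) * x ^ k"
        by (simp add: mconst_def ac_simps)
      also have "\<dots> \<in> I"
        by (intro mult Rn_mult_closed Rn_power_closed Rn_mconst_closed x y)
      finally show ?thesis .
    next
      case False
      then have "y ^ (k + l - i) = y ^ (k - i) * y ^ l" by (simp flip: power_add)
      then have "of_nat (k + l choose i) * x ^ i * y ^ (k + l - i)
          = (mconst (of_nat (k + l choose i)) * x ^ i * y ^ (k - i)) * y ^ l"
        by (simp add: mconst_def ac_simps)
      also have "\<dots> \<in> I"
        by (intro mult Rn_mult_closed Rn_power_closed Rn_mconst_closed x y)
      finally show ?thesis .
    qed
    then have "(x + y) ^ (k + l) \<in> I"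
      unfolding binomial_ring by (intro ideal_Rn_sum_closed[OF I]) auto
    then show "x + y \<in> ideal_radical (Rn n) I"
      using x y by (auto simp: rad Rn_add_closed)
  next
    fix x y :: "'k mpoly" assume "x \<in> ideal_radical (Rn n) I" "y \<in> carrier (Rn n)"
    then obtain k where "x \<in> carrier (Rn n)" "x ^ k \<in> I" "y \<in> carrier (Rn n)"
      by (auto simp: rad)
    then have "y * x \<in> carrier (Rn n)" "(y * x) ^ k \<in> I"
      by (simp_all add: power_mult_distrib mult Rn_mult_closed Rn_power_closed)
    then show "y * x \<in> ideal_radical (Rn n) I" unfolding rad by blast
  qed (auto simp: rad)
qed

text \<open>A monomial ideal is tested monomial by monomial. This turns the containments in the
  radical statement into conditions on exponents.\<close>

lemma Idl_mvar:
  assumes h: "h \<le> n"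
  shows "Idl\<^bsub>Rn n\<^esub> (mvar ` {..h})
    = {p \<in> carrier (Rn n :: 'k::comm_ring_1 mpoly ring). \<forall>u\<in>keys p. \<exists>i\<le>h. lookup u i \<noteq> 0}"
    (is "Idl\<^bsub>_\<^esub> ?X = ?J")
proof
  interpret ring "Rn n :: 'k mpoly ring" by (rule ring_Rn)
  have X: "?X \<subseteq> carrier (Rn n)" using h by (auto intro: Rn_mvar_closed)
  show "Idl\<^bsub>Rn n\<^esub> ?X \<subseteq> ?J"
  proof (rule genideal_minimal)
    show "ideal ?J (Rn n)"
    proof (rule ideal_RnI)
      fix x y :: "'k mpoly" assume "x \<in> ?J" "y \<in> ?J"
      then show "x + y \<in> ?J" using keys_add[of x y] by (auto intro: Rn_add_closed)
    next
      fix x y :: "'k mpoly" assume xy: "x \<in> ?J" "y \<in> carrier (Rn n)"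
      have "\<exists>i\<le>h. lookup w i \<noteq> 0" if w: "w \<in> keys (y * x)" for w
      proof -
        obtain u v where "w = u + v" "v \<in> keys x" using w keys_mult[of y x] by blast
        then show ?thesis using xy by (force simp: lookup_add)
      qed
      then show "y * x \<in> ?J" using xy by (auto intro: Rn_mult_closed)
    qed (auto simp: Rn_0_closed)
    show "?X \<subseteq> ?J" using X by (auto simp: mvar_def)
  qed
  show "?J \<subseteq> Idl\<^bsub>Rn n\<^esub> ?X"
  proof
    fix p assume p: "p \<in> ?J"
    interpret J: ideal "Idl\<^bsub>Rn n\<^esub> ?X" "Rn n" by (rule genideal_ideal[OF X])
    have "single u (lookup p u) \<in> Idl\<^bsub>Rn n\<^esub> ?X" if u: "u \<in> keys p" for u
    proof -
      obtain i where i: "i \<le> h" "lookup u i \<noteq> 0" using p u by blast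
      have "single u (lookup p u) = single (u - single i 1) (lookup p u) * mvar i"
        using sub_single_add_cancel[OF i(2)] by (simp add: mvar_def mult_single)
      moreover have "keys (u - single i 1) \<subseteq> {..n}"
        using p u by (auto simp: carrier_Rn in_keys_iff lookup_minus dest!: bspec subsetD[of _ _ _])
      then have "single (u - single i 1) (lookup p u) \<in> carrier (Rn n)"
        by (auto simp: carrier_Rn)
      moreover have "mvar i \<in> Idl\<^bsub>Rn n\<^esub> ?X" using genideal_self[OF X] i by auto
      ultimately show ?thesis
        using J.I_l_closed by simp
    qed
    then have "(\<Sum>u\<in>keys p. single u (lookup p u)) \<in> Idl\<^bsub>Rn n\<^esub> ?X"
      by (intro ideal_Rn_sum_closed[OF J.is_ideal])
    then show "p \<in> Idl\<^bsub>Rn n\<^esub> ?X"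
      using poly_mapping_eq_sum_single[of p] by simp
  qed
qed

text \<open>The ideal of the first variables is prime: setting them to zero is a homomorphism into a
  domain that leaves every other monomial unchanged. For \<open>k = 0\<close> the hypothesis fails,
  since 1 has the exponent 0.\<close>

lemma keys_power_prime:
  fixes f :: "'k::idom mpoly"
  assumes "\<forall>u\<in>keys (f ^ k). \<exists>i\<le>h. lookup u i \<noteq> 0"
  shows "\<forall>u\<in>keys f. \<exists>i\<le>h. lookup u i \<noteq> 0"
proof -
  define s where "s i = (if i \<le> h then 0 else mvar i :: 'k mpoly)" for i
  have kill: "monom_eval s u = 0" if "\<exists>i\<le>h. lookup u i \<noteq> 0" for u
    using that by (auto simp: s_def intro: monom_eval_eq_0)
  have keep: "monom_eval s u = single u 1" if "\<forall>i\<le>h. lookup u i = 0" for u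
  proof -
    have "monom_eval s u = (\<Prod>i\<in>keys u. mvar i ^ lookup u i)"
      unfolding monom_eval_def using that by (intro prod.cong refl) (auto simp: s_def in_keys_iff)
    also have "\<dots> = single (\<Sum>i\<in>keys u. single i (lookup u i)) 1"
    proof -
      have "(\<Prod>i\<in>A. mvar i ^ lookup u i :: 'k mpoly) = single (\<Sum>i\<in>A. single i (lookup u i)) 1" for A
        by (induction A rule: infinite_finite_induct) (simp_all add: mvar_power mult_single)
      then show ?thesis .
    qed
    finally show ?thesis by (simp flip: poly_mapping_eq_sum_single)
  qed
  have "eval_with mconst s (f ^ k) = 0"
    using assms by (auto simp: eval_with_def lin_ext_def kill intro!: sum.neutral)
  then have "eval_with mconst s f = 0"
    by (simp add: mconst.eval_power)
  moreover have "lookup (eval_with mconst s f) u = lookup f u" if u: "\<forall>i\<le>h. lookup u i = 0" for u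
  proof -
    have "lookup (mconst a * monom_eval s v) u = (if v = u then a else 0)" for v and a :: 'k
      using u by (cases "\<exists>i\<le>h. lookup v i \<noteq> 0")
        (auto simp: kill keep lookup_mconst_mult lookup_single when_def)
    then show ?thesis
      by (simp add: eval_with_def lin_ext_def lookup_sum in_keys_iff sum.delta)
  qed
  ultimately show ?thesis
    by (metis in_keys_iff lookup_zero)
qed

section \<open>The radical of the Hilbert ideal\<close>

lemma An_mconst: "mconst c \<in> An n"
  by (simp add: An_def Rn_mconst_closed derivation_mconst[OF derivation_weitzenboeck])

lemma An_add: "f \<in> An n \<Longrightarrow> g \<in> An n \<Longrightarrow> f + g \<in> An n"
  by (simp add: An_def Rn_add_closed derivation_add[OF derivation_weitzenboeck])

lemma An_mult: "f \<in> An n \<Longrightarrow> g \<in> An n \<Longrightarrow> f * g \<in> An n"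
  by (simp add: An_def Rn_mult_closed derivation_mult[OF derivation_weitzenboeck])

lemma An_uminus: "f \<in> An n \<Longrightarrow> - f \<in> An n"
  by (simp add: An_def Rn_uminus_closed derivation_uminus[OF derivation_weitzenboeck])

text \<open>The indices \<open>j\<close> and \<open>2 * i - j\<close> have the same parity, so the
  summands are symmetric under this reflection; the full range keeps the symmetry available. Only
  \<open>x\<^sub>i\<^sup>2\<close> occurs once, with coefficient 1 or -1.\<close>

definition quad :: "nat \<Rightarrow> 'k::comm_ring_1 mpoly" where
  "quad i = (\<Sum>j\<le>2 * i. of_int ((- 1) ^ j) * (mvar j * mvar (2 * i - j)))"

text \<open>The reflection \<open>j \<mapsto> 2 i - j\<close> identifies the two halves of the Leibniz rule, and
  \<open>j \<mapsto> 2 i - 1 - j\<close> shows that each half equals its own negative.\<close>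

lemma weitzenboeck_quad:
  assumes i: "2 * i \<le> n"
  shows "weitzenboeck n (quad i) = (0 :: 'k::field_char_0 mpoly)"
proof -
  let ?D = "weitzenboeck n :: 'k mpoly \<Rightarrow> 'k mpoly"
  define x where "x = (mvar :: nat \<Rightarrow> 'k mpoly)"
  define S where "S = (\<Sum>j\<le>2 * i. of_int ((- 1) ^ j) * (x j * ?D (x (2 * i - j))))"
  have "?D (quad i) = S + (\<Sum>j\<le>2 * i. of_int ((- 1) ^ j) * (x (2 * i - j) * ?D (x j)))"
    unfolding quad_def S_def x_def derivation_sum[OF derivation_weitzenboeck]
      derivation_of_int_mult[OF derivation_weitzenboeck]
    unfolding derivation_mult[OF derivation_weitzenboeck]
    by (simp add: distrib_left sum.distrib)
  also have "(\<Sum>j\<le>2 * i. of_int ((- 1) ^ j) * (x (2 * i - j) * ?D (x j))) = S"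
    unfolding S_def
    by (rule sum.reindex_bij_witness[of _ "\<lambda>j. 2 * i - j" "\<lambda>j. 2 * i - j"])
      (auto simp: minus_one_power_iff)
  finally have D: "?D (quad i) = S + S" .
  \<comment> \<open>The term \<open>j = 2 * i\<close> drops out because the derivation kills
    \<open>mvar 0\<close>; the others stay in the range where it shifts the index.\<close>
  have S: "S = (\<Sum>j<2 * i. of_int ((- 1) ^ j) * (x j * x (2 * i - 1 - j)))"
    unfolding S_def
    by (rule sum.mono_neutral_cong_right) (use i in \<open>auto simp: x_def weitzenboeck_mvar\<close>)
  also have "\<dots> = (\<Sum>j<2 * i. - (of_int ((- 1) ^ j) * (x j * x (2 * i - 1 - j))))"
    by (rule sum.reindex_bij_witness[of _ "\<lambda>j. 2 * i - 1 - j" "\<lambda>j. 2 * i - 1 - j"])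
      (auto simp: minus_one_power_iff)
  also have "\<dots> = - S" by (simp add: S sum_negf)
  finally have "S + S = 0" by (rule iffD1[OF eq_neg_iff_add_eq_0])
  with D show ?thesis by simp
qed

lemma quad_An_plus:
  assumes "2 * i \<le> n"
  shows "quad i \<in> (An_plus n :: 'k::field_char_0 mpoly set)"
proof -
  have "quad i \<in> carrier (Rn n :: 'k mpoly ring)"
    unfolding quad_def using assms Rn_mconst_closed[of "of_int _"]
    by (intro Rn_sum_closed Rn_mult_closed Rn_mvar_closed) (auto simp: mconst_of_int simp del: of_int_power)
  moreover have "lookup (quad i :: 'k mpoly) 0 = 0"
    by (simp add: quad_def lookup_sum lookup_of_int_mult lookup_mvar_mult del: of_int_power)
  ultimately show ?thesis
    using weitzenboeck_quad[OF assms] by (simp add: An_plus_def An_def)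
qed

text \<open>Off the middle, every term of \<open>quad i\<close> contains a variable of index below
  \<open>i\<close>. By induction that variable is known to lie in the radical, not in the ideal, so
  the argument runs inside the radical.\<close>

lemma mvar_in_radical:
  assumes "2 * i \<le> n"
  shows "mvar i \<in> ideal_radical (Rn n) (hilbert_ideal n :: 'k::field_char_0 mpoly set)"
  using assms
proof (induction i rule: less_induct)
  case (less i)
  interpret ring "Rn n :: 'k mpoly ring" by (rule ring_Rn)
  let ?I = "hilbert_ideal n :: 'k mpoly set"
  have sub: "An_plus n \<subseteq> carrier (Rn n :: 'k mpoly ring)"
    by (auto simp: An_plus_def An_def)
  have I: "ideal ?I (Rn n)" "quad i \<in> ?I"
    using genideal_ideal[OF sub] genideal_self[OF sub] quad_An_plus[OF less.prems]
    by (auto simp: hilbert_ideal_def)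
  let ?R = "ideal_radical (Rn n) ?I"
  interpret R: ideal ?R "Rn n" by (rule ideal_ideal_radical[OF I(1)])
  have const: "of_int k \<in> carrier (Rn n :: 'k mpoly ring)" for k
    using Rn_mconst_closed[of "of_int k"] by (simp add: mconst_of_int)
  have mult: "y * x \<in> ?R" if "x \<in> ?R" "y \<in> carrier (Rn n)" for x y
    using R.I_l_closed[OF that] by simp
  let ?t = "\<lambda>j. of_int ((- 1) ^ j) * (mvar j * mvar (2 * i - j)) :: 'k mpoly"
  have "?t j \<in> ?R" if j: "j \<le> 2 * i" "j \<noteq> i" for j
  proof (cases "j < i")
    case True
    then have "(of_int ((- 1) ^ j) * mvar (2 * i - j)) * mvar j \<in> ?R"
      using less j by (intro mult Rn_mult_closed const Rn_mvar_closed) auto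
    then show ?thesis by (simp add: ac_simps)
  next
    case False
    then have "(of_int ((- 1) ^ j) * mvar j) * mvar (2 * i - j) \<in> ?R"
      using less j by (intro mult Rn_mult_closed const Rn_mvar_closed) auto
    then show ?thesis by (simp add: ac_simps)
  qed
  then have rest: "(\<Sum>j\<in>{..2 * i} - {i}. ?t j) \<in> ?R"
    by (intro ideal_Rn_sum_closed[OF R.is_ideal]) auto
  have "quad i = ?t i + (\<Sum>j\<in>{..2 * i} - {i}. ?t j)"
    unfolding quad_def by (rule sum.remove) auto
  moreover have "2 * i - i = i" by simp
  ultimately have eq: "of_int ((- 1) ^ i) * (mvar i * mvar i)
      = quad i + (of_int (- 1) * (\<Sum>j\<in>{..2 * i} - {i}. ?t j))"
    by simp
  have "quad i \<in> carrier (Rn n :: 'k mpoly ring)"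
    using quad_An_plus[OF less.prems] sub by blast
  moreover have "quad i ^ 1 \<in> ?I" using I(2) by simp
  ultimately have "quad i \<in> ?R"
    unfolding ideal_radical_def Rn_nat_pow by blast
  then have "of_int ((- 1) ^ i) * (mvar i * mvar i) \<in> ?R"
    unfolding eq by (rule R.a_closed[OF _ mult[OF rest const], unfolded Rn_simps])
  then have "of_int ((- 1) ^ i) * (of_int ((- 1) ^ i) * (mvar i * mvar i)) \<in> ?R"
    by (rule mult) (rule const)
  moreover have "of_int ((- 1) ^ i) * (of_int ((- 1) ^ i) * y) = y" for y :: "'k mpoly"
    by (cases "even i") simp_all
  ultimately have "mvar i ^ 2 \<in> ?R"
    by (simp only: power2_eq_square)
  \<comment> \<open>A power of the square is a power of the variable, so the membership passes to
    \<open>mvar i\<close>.\<close>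
  then obtain k where "(mvar i ^ 2) ^ k \<in> ?I"
    unfolding ideal_radical_def Rn_nat_pow by blast
  then have "mvar i ^ (2 * k) \<in> ?I" by (simp only: power_mult)
  moreover have "mvar i \<in> carrier (Rn n :: 'k mpoly ring)"
    using less.prems by (intro Rn_mvar_closed) simp
  ultimately show ?case
    unfolding ideal_radical_def Rn_nat_pow by blast
qed

text \<open>The weight bound puts the generators of the Hilbert ideal into the ideal of variables,
  the zero constant term ruling out the exponent 0; primality then absorbs the radical.\<close>

lemma radical_hilbert_ideal:
  "ideal_radical (Rn n) (hilbert_ideal n :: 'k::field_char_0 mpoly set) = Idl\<^bsub>Rn n\<^esub> (mvar ` {..n div 2})"
proof
  interpret ring "Rn n :: 'k mpoly ring" by (rule ring_Rn)
  let ?I = "hilbert_ideal n :: 'k mpoly set" and ?J = "Idl\<^bsub>Rn n\<^esub> (mvar ` {..n div 2}) :: 'k mpoly set"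
  have X: "mvar ` {..n div 2} \<subseteq> carrier (Rn n :: 'k mpoly ring)"
    by (auto intro!: Rn_mvar_closed)
  have sub: "An_plus n \<subseteq> carrier (Rn n :: 'k mpoly ring)"
    by (auto simp: An_plus_def An_def)
  show "?J \<subseteq> ideal_radical (Rn n) ?I"
    using genideal_ideal[OF sub]
    by (intro genideal_minimal ideal_ideal_radical) (auto simp: hilbert_ideal_def[symmetric] intro!: mvar_in_radical)
  have "An_plus n \<subseteq> ?J"
  proof
    fix f :: "'k mpoly" assume f: "f \<in> An_plus n"
    then have "\<exists>i\<le>n div 2. lookup u i \<noteq> 0" if "u \<in> keys f" for u
      using An_keys_low[of f n u] that by (auto simp: An_plus_def in_keys_iff)
    with f sub show "f \<in> ?J" unfolding Idl_mvar[OF div_le_dividend] by blast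
  qed
  then have "?I \<subseteq> ?J"
    unfolding hilbert_ideal_def by (rule genideal_minimal[OF genideal_ideal[OF X]])
  show "ideal_radical (Rn n) ?I \<subseteq> ?J"
  proof
    fix f assume "f \<in> ideal_radical (Rn n) ?I"
    then obtain k where f: "f \<in> carrier (Rn n)" "f ^ k \<in> ?J"
      using \<open>?I \<subseteq> ?J\<close> by (auto simp: ideal_radical_def Rn_nat_pow)
    from f(2) have "\<forall>u\<in>keys (f ^ k). \<exists>i\<le>n div 2. lookup u i \<noteq> 0"
      unfolding Idl_mvar[OF div_le_dividend] by simp
    with f(1) show "f \<in> ?J"
      unfolding Idl_mvar[OF div_le_dividend] using keys_power_prime by blast
  qed
qed

section \<open>Images under the projections\<close>

lemma proj_eval_with: "proj m n = eval_with mconst (\<lambda>i. if i < n - m then 0 else mvar (i - (n - m)))"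
  by (simp add: proj_def msubst_eval_with)

lemma proj_mconst: "proj m n (mconst c) = mconst c"
  and proj_add: "proj m n (p + q) = proj m n p + proj m n q"
  and proj_mult: "proj m n (p * q) = proj m n p * proj m n q"
  and proj_uminus: "proj m n (- p) = - proj m n p"
  and proj_sum: "proj m n (sum f A) = (\<Sum>x\<in>A. proj m n (f x))"
  and proj_mvar: "proj m n (mvar i) = (if i < n - m then 0 else mvar (i - (n - m)))"
  by (simp_all add: proj_eval_with mconst.eval_mconst mconst.eval_add mconst.eval_mult
      mconst.eval_uminus mconst.eval_sum mconst.eval_mvar)

lemma proj_eq_sum_surviving:
  fixes p :: "'k::comm_ring_1 mpoly"
  shows
  "proj m n p = (\<Sum>u\<in>{u \<in> keys p. \<forall>i<n - m. lookup u i = 0}. mconst (lookup p u) *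
     monom_eval (\<lambda>i. if i < n - m then 0 else mvar (i - (n - m))) u)"
proof -
  have "monom_eval (\<lambda>i. if i < n - m then 0 else mvar (i - (n - m)) :: 'k mpoly) u = 0"
    if "\<not> (\<forall>i<n - m. lookup u i = 0)" for u
  proof -
    from that obtain i where "i < n - m" "lookup u i \<noteq> 0" by blast
    then show ?thesis by (intro monom_eval_eq_0[of _ i]) auto
  qed
  then have "\<forall>u\<in>keys p - {u \<in> keys p. \<forall>i<n - m. lookup u i = 0}. mconst (lookup p u) *
     monom_eval (\<lambda>i. if i < n - m then 0 else mvar (i - (n - m))) u = 0" by auto
  then show ?thesis
    unfolding proj_eval_with eval_with_def lin_ext_def
    by (intro sum.mono_neutral_right) auto
qed

lemma proj_An_constants:
  assumes n: "n \<ge> 1"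
  shows "proj (n - n div 2 - 1) n ` (An n :: 'k::field_char_0 mpoly set) = range mconst"
proof
  \<comment> \<open>The projection kills exactly the variables up to index \<open>n div 2\<close>.
    At \<open>n = 0\<close> truncated subtraction would break this equation.\<close>
  have n': "n - (n - n div 2 - 1) = Suc (n div 2)" using n by simp
  have "proj (n - n div 2 - 1) n f \<in> range mconst" if f: "f \<in> An n" for f :: "'k mpoly"
  proof -
    define S where "S = {u \<in> keys f. \<forall>i<Suc (n div 2). lookup u i = 0}"
    have "u = 0" if "u \<in> S" for u
      using An_keys_low[OF f, of u] that by (force simp: S_def)
    then have "S = {} \<or> S = {0}" by blast
    moreover have "proj (n - n div 2 - 1) n f = (\<Sum>u\<in>S. mconst (lookup f u) *
        monom_eval (\<lambda>i. if i < Suc (n div 2) then 0 else mvar (i - Suc (n div 2))) u)"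
      unfolding proj_eq_sum_surviving n' S_def ..
    ultimately have "proj (n - n div 2 - 1) n f = mconst 0 \<or> proj (n - n div 2 - 1) n f = mconst (lookup f 0)"
      by auto
    then show ?thesis by blast
  qed
  then show "proj (n - n div 2 - 1) n ` (An n :: 'k mpoly set) \<subseteq> range mconst" by blast
  have "mconst c \<in> proj (n - n div 2 - 1) n ` (An n :: 'k mpoly set)" for c
    using imageI[OF An_mconst[of c n], of "proj (n - n div 2 - 1) n"] by (simp only: proj_mconst)
  then show "range mconst \<subseteq> proj (n - n div 2 - 1) n ` (An n :: 'k mpoly set)" by blast
qed

text \<open>Computing the image for \<open>n = 2 * m\<close> thereby becomes the question which
  powers of \<open>mvar m\<close> occur in constants.\<close>

lemma proj_An_middle:
  fixes f :: "'k::field_char_0 mpoly"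
  assumes f: "f \<in> An (2 * m)"
  shows "proj m (2 * m) f = (\<Sum>u\<in>{u \<in> keys f. u = single m (lookup u m)}.
    mconst (lookup f u) * mvar 0 ^ lookup u m)"
proof -
  have low: "(\<forall>i<m. lookup u i = 0) \<longleftrightarrow> u = single m (lookup u m)" if u: "u \<in> keys f" for u
  proof
    assume "\<forall>i<m. lookup u i = 0"
    then have "lookup u i = 0" if "i \<noteq> m" for i
      using An_keys_middle[OF f u, of i] that by simp
    then show "u = single m (lookup u m)"
      by (intro poly_mapping_eqI) (auto simp: lookup_single when_def)
  next
    assume *: "u = single m (lookup u m)"
    have "lookup (single m (lookup u m)) i = 0" if "i < m" for i
      using that by (simp add: lookup_single when_def)
    with * show "\<forall>i<m. lookup u i = 0" by metis
  qed
  have eval: "monom_eval (\<lambda>i. if i < m then 0 else mvar (i - m)) u = (mvar 0 :: 'k mpoly) ^ lookup u m"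
    if "u = single m (lookup u m)" for u
    by (subst that, subst monom_eval_single) simp
  have m: "2 * m - m = m" by simp
  have "{u \<in> keys f. \<forall>i<m. lookup u i = 0} = {u \<in> keys f. u = single m (lookup u m)}"
    using low by blast
  then show ?thesis
    unfolding proj_eq_sum_surviving m
  proof (rule sum.cong)
    fix u assume "u \<in> {u \<in> keys f. u = single m (lookup u m)}"
    then have "u = single m (lookup u m)" by blast
    from eval[OF this] show "mconst (lookup f u) * monom_eval (\<lambda>i. if i < m then 0 else mvar (i - m)) u
        = mconst (lookup f u) * mvar 0 ^ lookup u m" by (rule arg_cong)
  qed
qed

text \<open>Unless \<open>j = m\<close>, one of \<open>j\<close> and \<open>2 * m - j\<close> is
  below \<open>m\<close> and its variable is killed.\<close>

lemma proj_quad: "proj m (2 * m) (quad m) = (of_int ((- 1) ^ m) * mvar 0 ^ 2 :: 'k::comm_ring_1 mpoly)"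
proof -
  have "proj m (2 * m) (quad m) = (\<Sum>j\<le>2 * m. of_int ((- 1) ^ j) *
      (proj m (2 * m) (mvar j) * proj m (2 * m) (mvar (2 * m - j))) :: 'k mpoly)"
    unfolding quad_def proj_sum proj_mult mconst_of_int[symmetric] proj_mconst ..
  also have "\<dots> = (\<Sum>j\<le>2 * m. if j = m then of_int ((- 1) ^ m) * mvar 0 ^ 2 else 0)"
    by (intro sum.cong refl) (auto simp: proj_mvar power2_eq_square)
  finally show ?thesis by simp
qed

section \<open>Constants restricted to an orbit of the additive group\<close>

interpretation coeff_poly: coeff_hom "\<lambda>c :: 'k::comm_ring_1. [:c:]"
  by unfold_locales (simp_all add: one_pCons)

interpretation coeff_id: coeff_hom "\<lambda>c :: 'k::comm_ring_1. c"
  by unfold_locales simp_all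

text \<open>The chain rule along an integral curve of the derivation, that is, along an orbit. A
  constant of the derivation therefore becomes a constant polynomial.\<close>

lemma pderiv_eval_with:
  fixes s :: "nat \<Rightarrow> 'k::field_char_0 poly"
  assumes s: "\<And>i. pderiv (s i) = (if 1 \<le> i \<and> i \<le> n then s (i - 1) else 0)"
  shows "pderiv (eval_with (\<lambda>c. [:c:]) s p) = eval_with (\<lambda>c. [:c:]) s (weitzenboeck n p)"
proof (induction p rule: mpoly_induct)
  case (const c)
  show ?case
    by (simp add: coeff_poly.eval_mconst derivation_mconst[OF derivation_weitzenboeck]
        coeff_poly.eval_0)
next
  case (var i)
  show ?case
    by (simp add: coeff_poly.eval_mvar weitzenboeck_mvar s coeff_poly.eval_0)
next
  case (add p q)
  then show ?case
    by (simp add: coeff_poly.eval_add derivation_add[OF derivation_weitzenboeck] pderiv_add)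
next
  case (mult p q)
  then show ?case
    by (simp add: coeff_poly.eval_mult coeff_poly.eval_add derivation_mult[OF derivation_weitzenboeck]
        pderiv_mult)
qed

lemma poly_eval_with:
  "poly (eval_with (\<lambda>c. [:c:]) s p) a = eval_with (\<lambda>c. c) (\<lambda>i. poly (s i) a) p"
  by (induction p rule: mpoly_induct)
    (simp_all add: coeff_poly.eval_mconst coeff_poly.eval_mvar coeff_poly.eval_add coeff_poly.eval_mult
      coeff_id.eval_mconst coeff_id.eval_mvar coeff_id.eval_add coeff_id.eval_mult)

lemma funpow_pderiv_eq_0:
  fixes p :: "'k::field_char_0 poly"
  shows "degree p < j \<Longrightarrow> (pderiv ^^ j) p = 0"
proof (induction j arbitrary: p)
  case (Suc j)
  have "(pderiv ^^ j) (pderiv p) = 0"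
  proof (cases "degree p = 0")
    case True
    then have "pderiv p = 0" by (simp add: pderiv_eq_0_iff)
    moreover have "(pderiv ^^ j) (0 :: 'k poly) = 0" by (induction j) simp_all
    ultimately show ?thesis by simp
  next
    case False
    then show ?thesis using Suc by (simp add: degree_pderiv)
  qed
  then show ?case by (simp add: funpow_swap1)
qed simp

text \<open>One differentiation preserves the shape: the exponent drops from \<open>m + 1\<close> to
  \<open>m\<close>, and the cofactor becomes (m + 1) h + (t - a) h', with value (m + 1) h(a) at
  \<open>a\<close>. These factors accumulate to the factorial.\<close>

lemma poly_funpow_pderiv_root:
  fixes h :: "'k::field_char_0 poly"
  shows "j \<le> m \<Longrightarrow> poly ((pderiv ^^ j) ([:- a, 1:] ^ m * h)) a = (if j = m then fact m * poly h a else 0)"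
proof (induction m arbitrary: j h)
  case (Suc m)
  show ?case
  proof (cases j)
    case 0
    then show ?thesis by simp
  next
    case (Suc l)
    have "pderiv ([:- a, 1:] ^ Suc m * h)
        = [:- a, 1:] ^ m * (smult (of_nat (Suc m)) h + [:- a, 1:] * pderiv h)"
      by (simp add: pderiv_mult pderiv_power_Suc pderiv_pCons algebra_simps del: power_Suc) (simp add: algebra_simps)
    then show ?thesis
      using Suc.IH[of l "smult (of_nat (Suc m)) h + [:- a, 1:] * pderiv h"] Suc.prems \<open>j = Suc l\<close>
      by (simp add: funpow_swap1 del: power_Suc of_nat_Suc)
  qed
qed simp

text \<open>The Rodrigues formula for Legendre polynomials provides an orbit joining two points at which the
  coordinates of index above \<open>m\<close> vanish and the middle coordinates differ by the sign \<open>(-1)\<^sup>m\<close>.\<close>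

definition rodrigues :: "nat \<Rightarrow> nat \<Rightarrow> 'k::field_char_0 poly" where
  "rodrigues m i = (if i \<le> 2 * m then (pderiv ^^ (2 * m - i)) ([:- 1, 1:] ^ m * [:1, 1:] ^ m) else 0)"

text \<open>At \<open>i = 0\<close> the derivative vanishes because (t^2 - 1)^m has degree at most
  \<open>2 * m\<close>; this matches the derivation killing \<open>mvar 0\<close>.\<close>

lemma pderiv_rodrigues:
  "pderiv (rodrigues m i) = (if 1 \<le> i \<and> i \<le> 2 * m then rodrigues m (i - 1) else (0 :: 'k::field_char_0 poly))"
proof (cases i)
  case 0
  have "degree ([:- 1, 1:] ^ m * [:1, 1:] ^ m :: 'k poly) \<le> m + m"
    using degree_mult_le[of "[:- 1, 1:] ^ m :: 'k poly" "[:1, 1:] ^ m"]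
      degree_power_le[of "[:- 1, 1:] :: 'k poly" m] degree_power_le[of "[:1, 1:] :: 'k poly" m]
    by simp
  then have "(pderiv ^^ Suc (2 * m)) ([:- 1, 1:] ^ m * [:1, 1:] ^ m :: 'k poly) = 0"
    by (intro funpow_pderiv_eq_0) simp
  with 0 show ?thesis by (simp add: rodrigues_def)
next
  case (Suc l)
  then have "2 * m - l = Suc (2 * m - i)" if "i \<le> 2 * m" using that by simp
  with Suc show ?thesis by (auto simp: rodrigues_def)
qed

text \<open>At most \<open>m\<close> derivatives are taken at a zero of order \<open>m\<close>, so
  only the \<open>m\<close>-th survives. The other factor contributes 2^m here and (-2)^m at -1,
  which is the source of the sign.\<close>

lemma poly_rodrigues_1:
  assumes "m \<le> i" "i \<le> 2 * m"
  shows "poly (rodrigues m i) 1 = (if i = m then fact m * 2 ^ m else (0 :: 'k::field_char_0))"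
  using poly_funpow_pderiv_root[of "2 * m - i" m "1 :: 'k" "[:1, 1:] ^ m"] assms
  by (auto simp: rodrigues_def)

lemma poly_rodrigues_minus_1:
  assumes "m \<le> i" "i \<le> 2 * m"
  shows "poly (rodrigues m i) (- 1) = (if i = m then fact m * (- 2) ^ m else (0 :: 'k::field_char_0))"
  using poly_funpow_pderiv_root[of "2 * m - i" m "- 1 :: 'k" "[:- 1, 1:] ^ m"] assms
  by (auto simp: rodrigues_def mult.commute)

text \<open>Vanishing coordinates beyond \<open>m\<close> exclude the variables of negative weight;
  total weight zero then excludes those of positive weight. So the values \<open>s i\<close> with
  \<open>i < m\<close> may be arbitrary.\<close>

lemma eval_weight_0_middle:
  fixes g :: "'k::field_char_0 mpoly"
  assumes keys: "\<And>u. u \<in> keys g \<Longrightarrow> keys u \<subseteq> {..2 * m}"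
    and weight: "\<And>u. u \<in> keys g \<Longrightarrow> wdeg (2 * m) (sl2_weight (2 * m)) u = 0"
    and deg: "\<And>u. u \<in> keys g \<Longrightarrow> wdeg (2 * m) (\<lambda>_. 1) u = int d"
    and s: "\<And>i. m < i \<Longrightarrow> i \<le> 2 * m \<Longrightarrow> s i = 0"
  shows "eval_with (\<lambda>c. c) s g = lookup g (single m d) * s m ^ d"
proof -
  have "monom_eval s u = 0" if u: "u \<in> keys g" "u \<noteq> single m d" for u
  proof (rule ccontr)
    assume "monom_eval s u \<noteq> 0"
    then have high: "lookup u i = 0" if "m < i" for i
      using monom_eval_eq_0[of s i u] s[of i] keys[OF u(1)] that
      by (cases "i \<le> 2 * m") (auto simp: in_keys_iff)
    have nonneg: "sl2_weight (2 * m) i * int (lookup u i) \<ge> 0" for i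
      using high[of i] by (cases "m < i") (auto simp: sl2_weight_def)
    have "\<forall>i\<in>{..2 * m}. sl2_weight (2 * m) i * int (lookup u i) = 0"
      using weight[OF u(1)] sum_nonneg_eq_0_iff[of "{..2 * m}", OF _ nonneg] by (simp add: wdeg_def)
    then have "lookup u i = 0" if "i \<noteq> m" for i
      using high[of i] that by (cases "m < i") (auto simp: sl2_weight_def)
    then have "u = single m (lookup u m)"
      by (intro poly_mapping_eqI) (auto simp: lookup_single when_def)
    moreover from this have "lookup u m = d"
      using deg[OF u(1)] wdeg_single[of "2 * m" "\<lambda>_. 1" m "lookup u m"] by simp
    ultimately show False using u(2) by simp
  qed
  then have "eval_with (\<lambda>c. c) s g = (\<Sum>u\<in>keys g \<inter> {single m d}. lookup g u * monom_eval s u)"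
    unfolding eval_with_def lin_ext_def by (intro sum.mono_neutral_right) auto
  also have "\<dots> = lookup g (single m d) * monom_eval s (single m d)"
    by (cases "single m d \<in> keys g") (simp_all add: in_keys_iff)
  finally show ?thesis by (simp add: monom_eval_single)
qed

text \<open>Passing to weight 0 and degree \<open>d\<close> keeps the coefficient in question and
  leaves it as the only contribution at both ends of the orbit. Equality of the two values makes it
  its own negative, up to a nonzero factor.\<close>

lemma An_odd_coefficient:
  fixes f :: "'k::field_char_0 mpoly"
  assumes f: "f \<in> An (2 * m)" and m: "odd m" and d: "odd d"
  shows "lookup f (single m d) = 0"
proof -
  define g where "g = wpart (2 * m) (\<lambda>_. 1) (int d) (wpart (2 * m) (sl2_weight (2 * m)) 0 f)"
  let ?ev = "eval_with (\<lambda>c. [:c:]) (rodrigues m) g"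
  have g: "lookup g (single m d) = lookup f (single m d)"
    by (simp add: g_def lookup_wpart wdeg_single sl2_weight_def)
  have kg: "u \<in> keys f" "wdeg (2 * m) (sl2_weight (2 * m)) u = 0" "wdeg (2 * m) (\<lambda>_. 1) u = int d"
    if "u \<in> keys g" for u
    using that by (auto simp: g_def keys_wpart)
  have "weitzenboeck (2 * m) (wpart (2 * m) (sl2_weight (2 * m)) 0 f) = 0"
    using An_weitzenboeck[OF f] by (subst weitzenboeck_wpart[where s = 2]) (auto simp: sl2_weight_def)
  then have "weitzenboeck (2 * m) g = 0"
    unfolding g_def by (subst weitzenboeck_wpart[where s = 0]) auto
  then have "pderiv ?ev = 0"
    by (subst pderiv_eval_with[OF pderiv_rodrigues]) (simp add: coeff_poly.eval_0)
  then have "poly ?ev 1 = poly ?ev (- 1)"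
    by (auto simp: pderiv_eq_0_iff elim!: degree_eq_zeroE)
  moreover have "poly ?ev a = lookup g (single m d) * poly (rodrigues m m) a ^ d" if "a = 1 \<or> a = - 1" for a
    unfolding poly_eval_with
  proof (rule eval_weight_0_middle)
    show "keys u \<subseteq> {..2 * m}" if "u \<in> keys g" for u
      using kg(1)[OF that] An_carrier[OF f] by (simp add: carrier_Rn)
    show "poly (rodrigues m i) a = 0" if "m < i" "i \<le> 2 * m" for i
      using \<open>a = 1 \<or> a = - 1\<close> that poly_rodrigues_1[of m i, where 'k = 'k]
        poly_rodrigues_minus_1[of m i, where 'k = 'k] by auto
  qed (use kg in auto)
  moreover have "poly (rodrigues m m) 1 = (fact m * 2 ^ m :: 'k)"
    "poly (rodrigues m m) (- 1) = (- (fact m * 2 ^ m) :: 'k)"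
    using m by (simp_all add: poly_rodrigues_1 poly_rodrigues_minus_1)
  ultimately have "lookup g (single m d) * (fact m * 2 ^ m) ^ d
      = - (lookup g (single m d) * (fact m * 2 ^ m) ^ d)"
    using d by simp
  then show ?thesis
    using g by simp
qed

text \<open>The linear term in the preceding variable of the derivative comes from this coefficient
  alone.\<close>

lemma An_linear_coefficient:
  fixes f :: "'k::comm_ring_1 mpoly"
  assumes f: "f \<in> An n" and m: "1 \<le> m" "m \<le> n"
  shows "lookup f (single m 1) = 0"
proof -
  obtain l where l: "m = Suc l" using m by (cases m) auto
  have "lookup (weitzenboeck n f) (single l 1) = (\<Sum>i<n. if i = l then lookup f (single m 1) else 0)"
    unfolding lookup_weitzenboeck by (intro sum.cong refl) (auto simp: lookup_single when_def l)
  also have "\<dots> = lookup f (single m 1)" using m l by simp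
  finally show ?thesis using An_weitzenboeck[OF f] by simp
qed

section \<open>A cubic constant\<close>

text \<open>Classical umbral notation: \<open>x\<^sub>0\<^sup>i x\<^sub>1\<^sup>j x\<^sub>2\<^sup>l\<close> stands for \<open>i! x\<^sub>i j! x\<^sub>j l! x\<^sub>l\<close>.
  The Weitzenboeck derivation becomes the sum of the three partial derivatives, so translation
  invariant polynomials turn into constants.\<close>

definition umbra :: "nat \<Rightarrow> 'k::comm_ring_1 mpoly" where
  "umbra i = of_nat (fact i) * mvar i"

definition umbral :: "'k mpoly \<Rightarrow> 'k::comm_ring_1 mpoly" where
  "umbral = lin_ext (\<lambda>u c. mconst c * (umbra (lookup u 0) * umbra (lookup u 1) * umbra (lookup u 2)))"

lemma umbral_single:
  "umbral (single u c) = mconst c * (umbra (lookup u 0) * umbra (lookup u 1) * umbra (lookup u 2))"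
  unfolding umbral_def by (rule lin_ext_single) simp

lemma umbral_add: "umbral (p + q) = umbral p + umbral q"
  unfolding umbral_def by (rule lin_ext_add) (simp_all add: mconst_add distrib_right)

lemma umbral_0: "umbral 0 = 0"
  by (simp add: umbral_def lin_ext_def)

lemma umbral_sum: "umbral (sum f A) = (\<Sum>x\<in>A. umbral (f x))"
  by (induction A rule: infinite_finite_induct) (simp_all add: umbral_0 umbral_add)

lemma mconst_of_nat: "mconst (of_nat k) = of_nat k"
  by (simp add: mconst_def)

text \<open>The factorial turns the index shift into the rule for the derivative of a power, since
  i! = i (i - 1)!. For \<open>i = 0\<close> the factor zero hides the truncated index.\<close>

lemma weitzenboeck_umbra:
  assumes "i \<le> n"
  shows "weitzenboeck n (umbra i) = of_nat i * umbra (i - 1)"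
proof -
  have "weitzenboeck n (umbra i) = of_nat (fact i) * weitzenboeck n (mvar i)"
    using derivation_mconst_mult[OF derivation_weitzenboeck, of n "of_nat (fact i)"]
    by (simp add: umbra_def mconst_of_nat del: of_nat_fact)
  then show ?thesis
    using assms by (cases i) (simp_all add: weitzenboeck_mvar umbra_def algebra_simps)
qed

definition translation :: "'k mpoly \<Rightarrow> 'k::comm_ring_1 mpoly" where
  "translation = vector_field {..2} (\<lambda>_. 1)"

lemma derivation_translation: "derivation translation"
  by (simp add: translation_def derivation_vector_field)

lemma translation_mvar: "i \<le> 2 \<Longrightarrow> translation (mvar i) = 1"
  by (simp add: translation_def vector_field_mvar)

lemma weitzenboeck_umbral_single:
  assumes "lookup u 0 \<le> n" "lookup u 1 \<le> n" "lookup u 2 \<le> n"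
  shows "weitzenboeck n (umbral (single u c)) = umbral (translation (single u c))"
proof -
  have "{..2 :: nat} = {0, 1, 2}" by auto
  then have "umbral (translation (single u c)) = umbral (pderiv_wrt 0 (single u c))
      + umbral (pderiv_wrt 1 (single u c)) + umbral (pderiv_wrt 2 (single u c))"
    by (simp add: translation_def vector_field_def umbral_add add.assoc)
  moreover have "umbral (pderiv_wrt 0 (single u c)) = mconst c *
      (of_nat (lookup u 0) * umbra (lookup u 0 - 1) * umbra (lookup u 1) * umbra (lookup u 2))"
    and "umbral (pderiv_wrt 1 (single u c)) = mconst c *
      (umbra (lookup u 0) * (of_nat (lookup u 1) * umbra (lookup u 1 - 1)) * umbra (lookup u 2))"
    and "umbral (pderiv_wrt 2 (single u c)) = mconst c *
      (umbra (lookup u 0) * umbra (lookup u 1) * (of_nat (lookup u 2) * umbra (lookup u 2 - 1)))"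
    by (simp_all add: pderiv_wrt_single umbral_single lookup_minus lookup_single when_def
        mconst_mult mconst_of_nat ac_simps)
  moreover have "weitzenboeck n (umbral (single u c)) = mconst c *
      (umbra (lookup u 0) * umbra (lookup u 1) * weitzenboeck n (umbra (lookup u 2))
       + umbra (lookup u 2) * (umbra (lookup u 0) * weitzenboeck n (umbra (lookup u 1))
         + umbra (lookup u 1) * weitzenboeck n (umbra (lookup u 0))))"
    unfolding umbral_single derivation_mconst_mult[OF derivation_weitzenboeck]
    unfolding derivation_mult[OF derivation_weitzenboeck] ..
  ultimately show ?thesis
    unfolding assms[THEN weitzenboeck_umbra] by (simp add: algebra_simps)
qed

text \<open>The bound on exponents keeps every umbra within the variables on which
  \<open>weitzenboeck n\<close> acts as a shift.\<close>

lemma weitzenboeck_umbral: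
  fixes p :: "'k::comm_ring_1 mpoly"
  assumes "\<And>u i. u \<in> keys p \<Longrightarrow> i \<le> 2 \<Longrightarrow> lookup u i \<le> n"
  shows "weitzenboeck n (umbral p) = umbral (translation p)"
proof -
  let ?s = "\<lambda>u. single u (lookup p u)"
  have "weitzenboeck n (umbral (\<Sum>u\<in>keys p. ?s u)) = umbral (translation (\<Sum>u\<in>keys p. ?s u))"
    unfolding umbral_sum derivation_sum[OF derivation_weitzenboeck] derivation_sum[OF derivation_translation]
    by (intro sum.cong refl weitzenboeck_umbral_single assms) auto
  then show ?thesis
    by (simp only: flip: poly_mapping_eq_sum_single)
qed

text \<open>Substituting \<open>x\<^sub>i\<^sup>-\<^sup>1\<close> for every \<open>x\<^sub>i\<close> and clearing denominators by the monomial \<open>t\<close> turns \<open>p\<close> into \<open>\<epsilon> p\<close>.\<close>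

definition palindromic :: "(nat \<Rightarrow>\<^sub>0 nat) \<Rightarrow> 'k \<Rightarrow> 'k::comm_ring_1 mpoly \<Rightarrow> bool" where
  "palindromic t \<epsilon> p \<longleftrightarrow> (\<forall>u\<in>keys p. \<forall>i. lookup u i \<le> lookup t i)
     \<and> (\<forall>u v. u + v = t \<longrightarrow> lookup p v = \<epsilon> * lookup p u)"

lemma add_diff_exponents:
  fixes u t :: "nat \<Rightarrow>\<^sub>0 nat"
  assumes "\<And>i. lookup u i \<le> lookup t i"
  shows "u + (t - u) = t"
  by (rule poly_mapping_eqI) (simp add: lookup_add lookup_minus assms)

lemma palindromic_lookup:
  "palindromic t \<epsilon> p \<Longrightarrow> u \<in> keys p \<Longrightarrow> lookup p (t - u) = \<epsilon> * lookup p u"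
  by (auto simp: palindromic_def add_diff_exponents)

text \<open>Since \<epsilon> is invertible, the complement \<open>t - u\<close> of a key is again a
  key, and complementation is an involution.\<close>

lemma palindromic_sum:
  assumes p: "palindromic t \<epsilon> p" and \<epsilon>: "\<epsilon> * \<epsilon> = 1"
  shows "(\<Sum>u\<in>keys p. F u) = (\<Sum>u\<in>keys p. F (t - u))"
proof -
  have "t - u \<in> keys p" if u: "u \<in> keys p" for u
  proof -
    have "\<epsilon> * lookup p (t - u) = lookup p u"
      using palindromic_lookup[OF p u] \<epsilon> by (simp flip: mult.assoc)
    with u show ?thesis by (metis in_keys_iff mult_zero_right)
  qed
  moreover have "t - (t - u) = u" if "u \<in> keys p" for u
    using p that add_diff_exponents[of u t] by (metis palindromic_def add_diff_cancel_right')
  ultimately show ?thesis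
    by (intro sum.reindex_bij_witness[of _ "\<lambda>u. t - u" "\<lambda>u. t - u"]) auto
qed

text \<open>Complement the exponents of both factors in the convolution sum. The bound in
  \<open>palindromic\<close> makes \<open>t - u\<close> a true complement despite truncated
  subtraction.\<close>

lemma palindromic_mult:
  assumes p: "palindromic t \<epsilon> p" "\<epsilon> * \<epsilon> = 1" and q: "palindromic t' \<epsilon>' q" "\<epsilon>' * \<epsilon>' = 1"
  shows "palindromic (t + t') (\<epsilon> * \<epsilon>') (p * q)"
  unfolding palindromic_def
proof (intro conjI ballI allI impI)
  fix w i assume "w \<in> keys (p * q)"
  then obtain u v where "w = u + v" "u \<in> keys p" "v \<in> keys q" using keys_mult[of p q] by blast
  then show "lookup w i \<le> lookup (t + t') i"
    using p(1) q(1) by (simp add: palindromic_def lookup_add add_mono)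
next
  fix w z assume wz: "w + z = t + t'"
  have iff: "(t - u) + (t' - v) = z \<longleftrightarrow> u + v = w" if "u \<in> keys p" "v \<in> keys q" for u v
  proof -
    have u: "u + (t - u) = t" and v: "v + (t' - v) = t'"
      using p(1) q(1) that by (auto simp: palindromic_def intro!: add_diff_exponents)
    have "(u + v) + ((t - u) + (t' - v)) = (u + (t - u)) + (v + (t' - v))"
      by (simp only: ac_simps)
    also have "\<dots> = w + z" by (simp only: u v wz)
    finally show ?thesis by (metis add_left_cancel add_right_cancel)
  qed
  have "lookup (p * q) z = (\<Sum>u\<in>keys p. \<Sum>v\<in>keys q. if u + v = z then lookup p u * lookup q v else 0)"
    by (rule lookup_mult_sum)
  also have "\<dots> = (\<Sum>u\<in>keys p. \<Sum>v\<in>keys q. if (t - u) + (t' - v) = z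
      then lookup p (t - u) * lookup q (t' - v) else 0)"
    by (subst palindromic_sum[OF p], subst palindromic_sum[OF q]) (rule refl)
  also have "\<dots> = (\<Sum>u\<in>keys p. \<Sum>v\<in>keys q. \<epsilon> * \<epsilon>' * (if u + v = w then lookup p u * lookup q v else 0))"
    by (intro sum.cong refl)
      (simp add: iff palindromic_lookup[OF p(1)] palindromic_lookup[OF q(1)] ac_simps)
  also have "\<dots> = \<epsilon> * \<epsilon>' * lookup (p * q) w"
    unfolding lookup_mult_sum sum_distrib_left ..
  finally show "lookup (p * q) z = \<epsilon> * \<epsilon>' * lookup (p * q) w" .
qed

lemma palindromic_power:
  assumes "palindromic t \<epsilon> p" "\<epsilon> * \<epsilon> = 1"
  shows "palindromic (\<Sum>i<k. t) (\<epsilon> ^ k) (p ^ k)"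
proof (induction k)
  case 0
  then show ?case by (auto simp: palindromic_def lookup_one when_def)
next
  case (Suc k)
  have "\<epsilon> ^ k * \<epsilon> ^ k = 1" using assms(2) by (simp flip: power_mult_distrib)
  moreover have "(\<Sum>i<Suc k. t) = t + (\<Sum>i<k. t)"
    by (simp only: sum.lessThan_Suc add.commute)
  ultimately show ?case
    unfolding power_Suc using palindromic_mult[OF assms Suc] by metis
qed

lemma keys_mvar_diff: "u \<in> keys (mvar a - mvar b) \<Longrightarrow> u = single a 1 \<or> u = single b 1"
  using keys_diff[of "mvar a" "mvar b"] by (auto simp: mvar_def in_keys_iff lookup_minus lookup_single when_def split: if_splits)

text \<open>This is a b (1/a - 1/b) = -(a - b), whence the sign -1.\<close>

lemma palindromic_mvar_diff: "palindromic (single a 1 + single b 1) (- 1) (mvar a - mvar b)"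
  unfolding palindromic_def
proof (intro conjI ballI allI impI)
  fix u i assume "u \<in> keys (mvar a - mvar b :: 'a mpoly)"
  then show "lookup u i \<le> lookup (single a 1 + single b 1) i"
    by (auto dest!: keys_mvar_diff simp: lookup_add)
next
  fix u v :: "nat \<Rightarrow>\<^sub>0 nat" assume uv: "u + v = single a 1 + single b 1"
  have "v = single a 1 \<longleftrightarrow> u = single b 1" "v = single b 1 \<longleftrightarrow> u = single a 1"
    using uv by (metis add.commute add_left_cancel)+
  then show "lookup (mvar a - mvar b :: 'a mpoly) v = - 1 * lookup (mvar a - mvar b) u"
    by (auto simp: mvar_def lookup_minus lookup_single when_def)
qed

section \<open>Powers of the product of differences\<close>

definition vandermonde :: "'k::comm_ring_1 mpoly" where
  "vandermonde = (mvar 0 - mvar 1) * (mvar 1 - mvar 2) * (mvar 2 - mvar 0)"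

text \<open>The summand collects the reversal exponents of the three linear factors. The total (a b
  c)^(2 k) plays two roles: it reverses the \<open>k\<close>-th power of \<open>vandermonde\<close>,
  and it is the middle monomial of the \<open>2 * k\<close>-th.\<close>

definition vandermonde_exponent :: "nat \<Rightarrow> (nat \<Rightarrow>\<^sub>0 nat)" where
  "vandermonde_exponent k = (\<Sum>i<k. single 0 1 + single 1 1 + (single 1 1 + single 2 1) + (single 2 1 + single 0 1))"

lemma lookup_vandermonde_exponent: "lookup (vandermonde_exponent k) i = (if i \<le> 2 then 2 * k else 0)"
  unfolding vandermonde_exponent_def lookup_sum by (auto simp: lookup_add lookup_single when_def)

lemma palindromic_vandermonde_power:
  "palindromic (vandermonde_exponent k) ((- 1) ^ k) (vandermonde ^ k :: 'k::comm_ring_1 mpoly)"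
proof -
  have "palindromic (single 0 1 + single 1 1 + (single 1 1 + single 2 1) + (single 2 1 + single 0 1))
      (- 1 * - 1 * - 1) (vandermonde :: 'k mpoly)"
    unfolding vandermonde_def by (intro palindromic_mult palindromic_mvar_diff) simp_all
  then show ?thesis
    unfolding vandermonde_exponent_def by (intro palindromic_power) simp_all
qed

lemma keys_vandermonde_power_degree:
  "u \<in> keys (vandermonde ^ k) \<Longrightarrow> wdeg 2 (\<lambda>_. 1) u = 3 * int k"
proof (induction k arbitrary: u)
  case 0
  then show ?case by (simp add: wdeg_def)
next
  case (Suc k)
  have mult: "\<exists>v w. u = v + w \<and> v \<in> keys p \<and> w \<in> keys q" if "u \<in> keys (p * q)" for u and p q :: "'a mpoly"
    using keys_mult[of p q] that by blast
  have diff: "wdeg 2 (\<lambda>_. 1) u = 1" if "u \<in> keys (mvar a - mvar b :: 'a mpoly)" "a \<le> 2" "b \<le> 2" for u a b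
    using keys_mvar_diff[OF that(1)] that(2,3) by (auto simp: wdeg_single)
  have "wdeg 2 (\<lambda>_. 1) u = 3" if u: "u \<in> keys (vandermonde :: 'a mpoly)" for u
  proof -
    obtain a b c where "u = a + b + c" "a \<in> keys (mvar 0 - mvar 1 :: 'a mpoly)"
      "b \<in> keys (mvar 1 - mvar 2 :: 'a mpoly)" "c \<in> keys (mvar 2 - mvar 0 :: 'a mpoly)"
      using u unfolding vandermonde_def by (blast dest: mult)
    then show ?thesis using diff[of a 0 1] diff[of b 1 2] diff[of c 2 0] by (simp add: wdeg_add)
  qed
  moreover obtain v w where "u = v + w" "v \<in> keys (vandermonde :: 'a mpoly)" "w \<in> keys (vandermonde ^ k :: 'a mpoly)"
    using mult[of u vandermonde "vandermonde ^ k"] Suc.prems by auto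
  ultimately show ?case using Suc.IH[of w] by (simp add: wdeg_add)
qed

lemma translation_vandermonde_power: "translation (vandermonde ^ k) = (0 :: 'k::comm_ring_1 mpoly)"
proof -
  have "translation (mvar i - mvar j) = (0 :: 'k mpoly)" if "i \<le> 2" "j \<le> 2" for i j
    using that by (simp add: derivation_diff[OF derivation_translation] translation_mvar)
  from this[of 0 1] this[of 1 2] this[of 2 0] have "translation vandermonde = (0 :: 'k mpoly)"
    by (simp add: vandermonde_def derivation_mult[OF derivation_translation])
  then show ?thesis
    by (rule derivation_power_eq_0[OF derivation_translation])
qed

text \<open>In a field such as the complex numbers a sum of nonzero squares may vanish; integrality
  moves the positivity argument to \<open>int\<close>.\<close>

lemma vandermonde_power_Ints: "lookup (vandermonde ^ k :: 'k::comm_ring_1 mpoly) u \<in> \<int>"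
proof -
  have mult: "lookup (p * q) u \<in> \<int>" if "\<And>u. lookup p u \<in> \<int>" "\<And>u. lookup q u \<in> \<int>" for u and p q :: "'k mpoly"
    unfolding lookup_mult_sum by (intro Ints_sum) (auto intro: Ints_mult that)
  have diff: "lookup (mvar a - mvar b :: 'k mpoly) u \<in> \<int>" for a b u
    by (simp add: mvar_def lookup_minus lookup_single when_def)
  have "lookup (vandermonde :: 'k mpoly) u \<in> \<int>" for u
    unfolding vandermonde_def by (intro mult diff)
  then show ?thesis
    by (induction k arbitrary: u) (auto simp: lookup_one when_def intro: mult)
qed

text \<open>By the palindromic symmetry this coefficient (Dixon's alternating sum of cubed binomial
  coefficients) is, up to sign, the sum of the squares of the integer coefficients of \<open>vandermonde ^ k\<close>.\<close>

lemma vandermonde_middle_coefficient: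
  "lookup (vandermonde ^ (2 * k)) (vandermonde_exponent k) \<noteq> (0 :: 'k::field_char_0)"
proof -
  let ?P = "vandermonde ^ k :: 'k mpoly" and ?t = "vandermonde_exponent k"
  define a where "a u = (SOME z :: int. lookup ?P u = of_int z)" for u
  have a: "lookup ?P u = of_int (a u)" for u
    unfolding a_def using vandermonde_power_Ints[of k u, where 'k = 'k]
    by (intro someI_ex[of "\<lambda>z. lookup ?P u = of_int z"]) (auto elim: Ints_cases)
  have "u + v = ?t \<longleftrightarrow> v = ?t - u" if "u \<in> keys ?P" for u v
  proof -
    have "u + (?t - u) = ?t"
      using palindromic_vandermonde_power[of k, where 'k = 'k] that
      by (auto simp: palindromic_def intro!: add_diff_exponents)
    then show ?thesis by (metis add_left_cancel)
  qed
  then have "lookup (?P * ?P) ?t = (\<Sum>u\<in>keys ?P. \<Sum>v\<in>keys ?P. if v = ?t - u then lookup ?P u * lookup ?P v else 0)"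
    unfolding lookup_mult_sum by (intro sum.cong refl) simp
  also have "\<dots> = (\<Sum>u\<in>keys ?P. lookup ?P u * lookup ?P (?t - u))"
    by (intro sum.cong refl) (simp add: sum.delta in_keys_iff)
  also have "\<dots> = (\<Sum>u\<in>keys ?P. (- 1) ^ k * of_int (a u ^ 2))"
  proof (intro sum.cong refl)
    fix u assume "u \<in> keys ?P"
    then have "lookup ?P (?t - u) = (- 1) ^ k * lookup ?P u"
      by (rule palindromic_lookup[OF palindromic_vandermonde_power])
    then show "lookup ?P u * lookup ?P (?t - u) = (- 1) ^ k * of_int (a u ^ 2)"
      by (simp only: a[of u] of_int_mult power2_eq_square ac_simps)
  qed
  also have "\<dots> = (- 1) ^ k * of_int (\<Sum>u\<in>keys ?P. a u ^ 2)"
    by (simp add: sum_distrib_left)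
  finally have eq: "lookup (?P * ?P) ?t = (- 1) ^ k * of_int (\<Sum>u\<in>keys ?P. a u ^ 2)" .
  \<comment> \<open>The linear factors are nonzero, so in a domain the power is nonzero and at least
    one square is positive.\<close>
  have "mvar i \<noteq> (mvar j :: 'k mpoly)" if "i \<noteq> j" for i j
  proof
    assume "mvar i = (mvar j :: 'k mpoly)"
    then have "lookup (mvar i :: 'k mpoly) (single i 1) = lookup (mvar j :: 'k mpoly) (single i 1)" by simp
    moreover have "single j 1 \<noteq> single i (1 :: nat)"
      using that by (metis lookup_single_eq lookup_single_not_eq zero_neq_one)
    ultimately show False by (simp add: mvar_def lookup_single when_def)
  qed
  then have "?P \<noteq> 0" by (simp add: vandermonde_def)
  then obtain u where "u \<in> keys ?P" by (metis all_not_in_conv keys_eq_empty)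
  moreover from this have "a u \<noteq> 0" using a[of u] by (auto simp: in_keys_iff)
  ultimately have "(\<Sum>u\<in>keys ?P. a u ^ 2) > 0" by (intro sum_pos2[of _ u]) auto
  then show ?thesis
    unfolding mult_2 power_add eq by (simp del: of_int_sum)
qed

lemma umbral_carrier:
  fixes p :: "'k::comm_ring_1 mpoly"
  assumes "\<And>u i. u \<in> keys p \<Longrightarrow> i \<le> 2 \<Longrightarrow> lookup u i \<le> n"
  shows "umbral p \<in> carrier (Rn n)"
proof -
  have "umbra i \<in> carrier (Rn n :: 'k mpoly ring)" if "i \<le> n" for i
    unfolding umbra_def mconst_of_nat[symmetric] using that
    by (intro Rn_mult_closed Rn_mconst_closed Rn_mvar_closed)
  then show ?thesis
    unfolding umbral_def lin_ext_def
    by (intro Rn_sum_closed Rn_mult_closed Rn_mconst_closed) (simp_all add: assms)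
qed

text \<open>With \<open>m = 2 * k\<close>, the exponents in \<open>vandermonde ^ m\<close> are at
  most \<open>2 * m\<close>, so the umbral image stays in the ring. The projection needs all three
  exponents to be at least \<open>m\<close>; as they add up to \<open>3 * m\<close>, a single
  monomial survives, and its nonzero coefficient can be normalised.\<close>

lemma cubic_constant:
  obtains f :: "'k::field_char_0 mpoly"
  where "f \<in> An (4 * k)" "proj (2 * k) (4 * k) f = mvar 0 ^ 3"
proof -
  let ?m = "2 * k" and ?G = "vandermonde ^ (2 * k) :: 'k mpoly"
  define c where "c = lookup ?G (vandermonde_exponent k)"
  have bound: "lookup u i \<le> (if i \<le> 2 then 4 * k else 0)" if "u \<in> keys ?G" for u i
  proof -
    have "lookup u i \<le> lookup (vandermonde_exponent (2 * k)) i"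
      using palindromic_vandermonde_power[of "2 * k", where 'k = 'k] that
      unfolding palindromic_def by blast
    then show ?thesis by (simp add: lookup_vandermonde_exponent split: if_splits)
  qed
  have An: "umbral ?G \<in> An (4 * k)"
  proof -
    have "lookup u i \<le> 4 * k" if "u \<in> keys ?G" "i \<le> 2" for u i
      using bound[OF that(1), of i] that(2) by simp
    then show ?thesis
      by (simp add: An_def umbral_carrier weitzenboeck_umbral translation_vandermonde_power umbral_0)
  qed
  let ?pr = "proj ?m (4 * k) :: 'k mpoly \<Rightarrow> _"
  have pr_umbra: "?pr (umbra i) = (if i < ?m then 0 else of_nat (fact i) * mvar (i - ?m))" for i
    unfolding umbra_def mconst_of_nat[symmetric] proj_mult proj_mconst by (simp add: proj_mvar)
  define T where "T u = mconst (lookup ?G u) *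
      (?pr (umbra (lookup u 0)) * ?pr (umbra (lookup u 1)) * ?pr (umbra (lookup u 2)))" for u
  have T: "T u = 0" if u: "u \<in> keys ?G" "u \<noteq> vandermonde_exponent k" for u
  proof (rule ccontr)
    assume "T u \<noteq> 0"
    then have "lookup u 0 \<ge> ?m" "lookup u 1 \<ge> ?m" "lookup u 2 \<ge> ?m"
      by (auto simp: T_def pr_umbra split: if_splits)
    moreover have "{..2 :: nat} = {0, 1, 2}" by auto
    then have "lookup u 0 + lookup u 1 + lookup u 2 = 3 * ?m"
      using keys_vandermonde_power_degree[OF u(1)] by (simp add: wdeg_def)
    ultimately have "lookup u 0 = ?m" "lookup u 1 = ?m" "lookup u 2 = ?m" by linarith+
    moreover have "lookup u i = 0" if "i > 2" for i
      using bound[OF u(1), of i] that by simp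
    ultimately have "lookup u i = lookup (vandermonde_exponent k) i" for i
      unfolding lookup_vandermonde_exponent
      by (cases "i > 2"; cases "i = 0"; cases "i = 1"; cases "i = 2") auto
    then have "u = vandermonde_exponent k" by (rule poly_mapping_eqI)
    with u(2) show False ..
  qed
  have c: "c \<noteq> 0" "vandermonde_exponent k \<in> keys ?G"
    using vandermonde_middle_coefficient[of k, where 'k = 'k] by (auto simp: c_def in_keys_iff)
  have "?pr (umbral ?G) = (\<Sum>u\<in>keys ?G. T u)"
    unfolding umbral_def lin_ext_def proj_sum proj_mult proj_mconst T_def ..
  also have "\<dots> = (\<Sum>u\<in>{vandermonde_exponent k}. T u)"
    by (rule sum.mono_neutral_right) (use c T in auto)
  also have "\<dots> = T (vandermonde_exponent k)" by simp
  also have "\<dots> = mconst (c * of_nat (fact ?m) ^ 3) * mvar 0 ^ 3"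
  proof -
    have l: "lookup (vandermonde_exponent k) 0 = ?m" "lookup (vandermonde_exponent k) 1 = ?m"
      "lookup (vandermonde_exponent k) 2 = ?m"
      by (simp_all add: lookup_vandermonde_exponent)
    have pr: "?pr (umbra ?m) = mconst (of_nat (fact ?m)) * mvar 0"
      unfolding pr_umbra mconst_of_nat by simp
    show ?thesis
      unfolding T_def l pr c_def[symmetric]
      by (simp add: power3_eq_cube mconst_mult ac_simps)
  qed
  finally have pr: "?pr (umbral ?G) = mconst (c * of_nat (fact ?m) ^ 3) * mvar 0 ^ 3" .
  have "inverse (c * of_nat (fact ?m) ^ 3) * (c * of_nat (fact ?m) ^ 3) = 1"
    using c(1) by (intro left_inverse) simp
  then have "?pr (mconst (inverse (c * of_nat (fact ?m) ^ 3)) * umbral ?G) = mvar 0 ^ 3"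
    unfolding proj_mult proj_mconst pr mult.assoc[symmetric] mconst_mult[symmetric] by simp
  then show ?thesis using that An_mult[OF An_mconst An] by blast
qed

section \<open>The images as generated subalgebras\<close>

context
  fixes m :: nat and S :: "'k::field_char_0 mpoly set"
begin

lemma generated_subalgebra_mult:
  "p \<in> generated_subalgebra m S \<Longrightarrow> q \<in> generated_subalgebra m S \<Longrightarrow> p * q \<in> generated_subalgebra m S"
  using generate_ring.eng_mult[of p "Rn m" _ q] by (simp add: generated_subalgebra_def)

lemma generated_subalgebra_mconst: "mconst c \<in> generated_subalgebra m S"
  by (auto simp: generated_subalgebra_def intro: generate_ring.incl)

lemma generated_subalgebra_power:
  "p \<in> generated_subalgebra m S \<Longrightarrow> p ^ k \<in> generated_subalgebra m S"
  by (induction k) (use generated_subalgebra_mconst[of 1] in \<open>auto intro: generated_subalgebra_mult\<close>)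

lemma generated_subalgebra_sum:
  "(\<And>x. x \<in> A \<Longrightarrow> f x \<in> generated_subalgebra m S) \<Longrightarrow> sum f A \<in> generated_subalgebra m S"
proof (induction A rule: infinite_finite_induct)
  case (insert x A)
  then show ?case
    using generate_ring.eng_add[of "f x" "Rn m" _ "sum f A"] by (simp add: generated_subalgebra_def)
qed (use generated_subalgebra_mconst[of 0] in auto)

lemma generated_subalgebra_incl: "p \<in> S \<Longrightarrow> p \<in> generated_subalgebra m S"
  by (auto simp: generated_subalgebra_def intro: generate_ring.incl)

lemma proj_An_subset:
  assumes "\<And>(f :: 'k mpoly) d. f \<in> An (2 * m) \<Longrightarrow> lookup f (single m d) \<noteq> 0 \<Longrightarrow> mvar 0 ^ d \<in> generated_subalgebra m S"
  shows "proj m (2 * m) ` An (2 * m) \<subseteq> generated_subalgebra m S"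
proof
  fix p :: "'k mpoly" assume "p \<in> proj m (2 * m) ` An (2 * m)"
  then obtain f where f: "f \<in> An (2 * m)" "p = proj m (2 * m) f" by blast
  have "mvar 0 ^ lookup u m \<in> generated_subalgebra m S" if "u \<in> keys f" "u = single m (lookup u m)" for u
    using assms[OF f(1), of "lookup u m"] that by (metis in_keys_iff)
  then show "p \<in> generated_subalgebra m S"
    unfolding f(2) proj_An_middle[OF f(1)]
    by (intro generated_subalgebra_sum generated_subalgebra_mult generated_subalgebra_mconst) blast
qed

lemma generated_subalgebra_subset_proj_An:
  assumes S: "S \<subseteq> carrier (Rn m)" "S \<subseteq> proj m n ` An n"
  shows "generated_subalgebra m S \<subseteq> proj m n ` An n"
proof
  fix p assume "p \<in> generated_subalgebra m S"
  then show "p \<in> proj m n ` An n"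
    unfolding generated_subalgebra_def
  proof (induction p rule: generate_ring.induct)
    case one
    have "proj m n (mconst 1) = (1 :: 'k mpoly)" unfolding proj_mconst by simp
    then show ?case
      using imageI[OF An_mconst[of "1 :: 'k" n], of "proj m n"] by (simp only: Rn_simps)
  next
    case (incl h)
    have "mconst c \<in> proj m n ` An n" for c :: 'k
      using imageI[OF An_mconst[of c n], of "proj m n"] by (simp only: proj_mconst)
    then show ?case using incl S(2) by blast
  next
    case (a_inv h)
    \<comment> \<open>The additive inverse of the ring record is identified with unary minus only on
      the carrier.\<close>
    have "h \<in> carrier (Rn m)"
      using a_inv.hyps S(1) ring.generate_ring_in_carrier[OF ring_Rn]
      by (metis (no_types, lifting) Rn_mconst_closed Un_least image_subset_iff)
    moreover obtain f where "f \<in> An n" "h = proj m n f" using a_inv.IH by blast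
    ultimately show ?case
      using An_uminus by (auto simp: Rn_a_inv simp flip: proj_uminus)
  next
    case (eng_add h1 h2)
    then show ?case by (auto simp flip: proj_add intro: An_add)
  next
    case (eng_mult h1 h2)
    then show ?case by (auto simp flip: proj_mult intro: An_mult)
  qed
qed

end

lemma mvar_square_in_proj_An: "mvar 0 ^ 2 \<in> proj m (2 * m) ` (An (2 * m) :: 'k::field_char_0 mpoly set)"
proof -
  have "quad m \<in> (An (2 * m) :: 'k mpoly set)"
    using quad_An_plus[of m "2 * m"] by (auto simp: An_plus_def)
  then have "mconst ((- 1) ^ m) * quad m \<in> (An (2 * m) :: 'k mpoly set)"
    by (intro An_mult An_mconst)
  moreover have "proj m (2 * m) (mconst ((- 1) ^ m) * quad m) = (mvar 0 ^ 2 :: 'k mpoly)"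
    unfolding proj_mult proj_mconst proj_quad
    using mconst_of_int[of "(- 1) ^ m", where 'a = 'k] by (cases "even m") simp_all
  ultimately show ?thesis by (metis imageI)
qed

lemma proj_An_odd:
  assumes m: "odd m"
  shows "proj m (2 * m) ` (An (2 * m) :: 'k::field_char_0 mpoly set) = generated_subalgebra m {mvar 0 ^ 2}"
proof
  show "proj m (2 * m) ` (An (2 * m) :: 'k mpoly set) \<subseteq> generated_subalgebra m {mvar 0 ^ 2}"
  proof (rule proj_An_subset)
    fix f :: "'k mpoly" and d assume "f \<in> An (2 * m)" "lookup f (single m d) \<noteq> 0"
    then have "even d" using An_odd_coefficient m by blast
    then obtain l where "d = 2 * l" ..
    then show "mvar 0 ^ d \<in> generated_subalgebra m {mvar 0 ^ 2 :: 'k mpoly}"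
      by (simp only: power_mult) (intro generated_subalgebra_power generated_subalgebra_incl, simp)
  qed
  show "generated_subalgebra m {mvar 0 ^ 2} \<subseteq> proj m (2 * m) ` (An (2 * m) :: 'k mpoly set)"
    using mvar_square_in_proj_An
    by (intro generated_subalgebra_subset_proj_An) (auto intro: Rn_power_closed Rn_mvar_closed)
qed

text \<open>The exponents 2 and 3 generate every natural number except 1, and exponent 1 is excluded
  by \<open>An_linear_coefficient\<close>.\<close>

lemma proj_An_even:
  assumes m: "m \<ge> 1" "even m"
  shows "proj m (2 * m) ` (An (2 * m) :: 'k::field_char_0 mpoly set)
    = generated_subalgebra m {mvar 0 ^ 2, mvar 0 ^ 3}"
proof
  let ?g = "generated_subalgebra m {mvar 0 ^ 2, mvar 0 ^ 3} :: 'k mpoly set"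
  show "proj m (2 * m) ` (An (2 * m) :: 'k mpoly set) \<subseteq> ?g"
  proof (rule proj_An_subset)
    fix f :: "'k mpoly" and d assume "f \<in> An (2 * m)" "lookup f (single m d) \<noteq> 0"
    then have d: "d \<noteq> 1" using An_linear_coefficient[of f "2 * m" m] m by auto
    have sq: "(mvar 0 ^ 2) ^ l \<in> ?g" for l
      by (intro generated_subalgebra_power generated_subalgebra_incl) simp
    show "mvar 0 ^ d \<in> ?g"
    proof (cases "even d")
      case True
      then obtain l where "d = 2 * l" ..
      then show ?thesis using sq[of l] by (simp only: power_mult)
    next
      case False
      then obtain l where "d = 2 * l + 1" by (rule oddE)
      with d obtain j where "d = 3 + 2 * j" by (cases l) auto
      moreover have "mvar 0 ^ 3 * (mvar 0 ^ 2) ^ j \<in> ?g"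
        by (intro generated_subalgebra_mult sq generated_subalgebra_incl) simp
      ultimately show ?thesis by (simp only: power_add power_mult)
    qed
  qed
  obtain k where k: "m = 2 * k" using m(2) ..
  obtain f :: "'k mpoly" where "f \<in> An (4 * k)" "proj (2 * k) (4 * k) f = mvar 0 ^ 3"
    by (rule cubic_constant)
  then have "mvar 0 ^ 3 \<in> proj m (2 * m) ` (An (2 * m) :: 'k mpoly set)"
    unfolding k by (simp add: image_iff) metis
  then show "?g \<subseteq> proj m (2 * m) ` (An (2 * m) :: 'k mpoly set)"
    using mvar_square_in_proj_An
    by (intro generated_subalgebra_subset_proj_An) (auto intro: Rn_power_closed Rn_mvar_closed)
qed

theorem proposition3p1:
  shows "(\<forall>n\<ge>1. ideal_radical (Rn n) (hilbert_ideal n :: 'k::field_char_0 mpoly set)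
             = Idl\<^bsub>Rn n\<^esub> (mvar ` {..n div 2}))
    \<and> (\<forall>n\<ge>1. proj (n - n div 2 - 1) n ` (An n :: 'k mpoly set) = range mconst)
    \<and> (\<forall>m\<ge>1. odd m \<longrightarrow>
          proj m (2 * m) ` (An (2 * m) :: 'k mpoly set)
            = generated_subalgebra m {mvar 0 ^ 2})
    \<and> (\<forall>m\<ge>2. even m \<longrightarrow>
          proj m (2 * m) ` (An (2 * m) :: 'k mpoly set)
            = generated_subalgebra m {mvar 0 ^ 2, mvar 0 ^ 3})"
  by (intro conjI allI impI radical_hilbert_ideal proj_An_constants proj_An_odd proj_An_even) simp_all

end
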